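(* Let $B, C$ be integers and consider the binary recurrence relation $u_{n+2} = B u_{n+1} - C u_n$ with characteristic polynomial $f(x) = x^2 - Bx + C$, having roots $\alpha_1, \alpha_2$, and assume the recurrence is non-degenerate. Let $\Delta = B^2 - 4C$ be the discriminant of $f$. Then the realisable subspace of this recurrence has (1) dimension $0$ if $\Delta < 0$; (2) dimension $1$ if $\Delta = 0$, or if $\Delta > 0$ and $\Delta$ is not a perfect square; (3) dimension $2$ if $\Delta > 0$ is a perfect square.
   Context: A sequence $(v_n)_{n\ge1}$ of non-negative integers is called realisable if there exist a set $X$ and a map $T: X \to X$ such that for every $n \ge 1$ the set $\mathrm{Per}_n(T) = \{x \in X : T^n(x) = x\}$ is finite and $|\mathrm{Per}_n(T)| = v_n$. The recurrence is non-degenerate if $\alpha_1/\alpha_2$ is not a root of unity. The complex solutions $(u_n)_{n\ge1}$ of the recurrence form a $2$-dimensional $\mathbb{C}$-vector space; an integer-valued solution $(u_n)$ is called realisable if the sequence of absolute values $(|u_n|)_{n \ge 1}$ is realisable. The realisable subspace is the $\mathbb{C}$-subspace of the solution space spanned by the realisable integer solutions. *)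

theory Defs
  imports
    "HOL-Analysis.Analysis"
    "HOL-Library.Function_Algebras"
    "HOL-Computational_Algebra.Polynomial"
    "HOL-Computational_Algebra.Nth_Powers"
begin

definition Per :: "'a set \<Rightarrow> ('a \<Rightarrow> 'a) \<Rightarrow> nat \<Rightarrow> 'a set" where
  "Per X T n = {x \<in> X. (T ^^ n) x = x}"

definition realises :: "'a set \<Rightarrow> ('a \<Rightarrow> 'a) \<Rightarrow> (nat \<Rightarrow> nat) \<Rightarrow> bool" where
  "realises X T v \<longleftrightarrow> T ` X \<subseteq> X \<and> (\<forall>n\<ge>1. finite (Per X T n) \<and> card (Per X T n) = v n)"

text \<open>
  HOL cannot quantify existentially over the type of the points of \<open>X\<close>. Points of \<open>nat\<close> suffice:
  the periodic points alone already realise the sequence, and there are only countably many of them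
  (lemma \<open>realises_imp_realisable\<close>).
\<close>

definition realisable :: "(nat \<Rightarrow> nat) \<Rightarrow> bool" where
  "realisable v \<longleftrightarrow> (\<exists>(X :: nat set) T. realises X T v)"

lemma realises_imp_realisable:
  fixes X :: "'a set"
  assumes "realises X T v"
  shows "realisable v"
proof -
  define P where "P = (\<Union>n\<in>{1..}. Per X T n)"
  have TX: "T x \<in> X" if "x \<in> X" for x
    using assms that by (auto simp: realises_def)
  have fin: "finite (Per X T n)" and crd: "card (Per X T n) = v n" if "n \<ge> 1" for n
    using assms that by (auto simp: realises_def)
  have "countable P"
    unfolding P_def by (rule countable_UN) (auto intro!: countable_finite fin)
  then obtain f :: "'a \<Rightarrow> nat" where f: "inj_on f P"
    by (auto simp: countable_def)
  have PX: "P \<subseteq> X" by (auto simp: P_def Per_def)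
  have TP: "T x \<in> P" if "x \<in> P" for x
  proof -
    from that obtain n where n: "n \<ge> 1" "x \<in> X" "(T ^^ n) x = x"
      by (auto simp: P_def Per_def)
    have "(T ^^ n) (T x) = T x"
      using n(3) by (metis funpow_swap1)
    with n TX show ?thesis by (auto simp: P_def Per_def)
  qed
  define S where "S = (\<lambda>k. f (T (inv_into P f k)))"
  have S: "S (f x) = f (T x)" if "x \<in> P" for x
    using f that by (simp add: S_def)
  have TnP: "(T ^^ n) x \<in> P" if "x \<in> P" for x n
    using that by (induction n) (auto intro: TP)
  have Sn: "(S ^^ n) (f x) = f ((T ^^ n) x)" if "x \<in> P" for x n
    using that by (induction n) (auto simp: S TnP)
  have Per_eq: "Per (f ` P) S n = f ` Per X T n" if "n \<ge> 1" for n
  proof -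
    have "Per (f ` P) S n = f ` Per P T n"
      using f by (auto simp: Per_def Sn TnP inj_on_eq_iff)
    moreover have "Per P T n = Per X T n"
      using that PX by (auto simp: P_def Per_def)
    ultimately show ?thesis by simp
  qed
  have "realises (f ` P) S v"
    unfolding realises_def
  proof (intro conjI allI impI)
    show "S ` f ` P \<subseteq> f ` P" using TP S by auto
    fix n :: nat assume n: "n \<ge> 1"
    have "inj_on f (Per X T n)"
      using n by (intro inj_on_subset[OF f]) (auto simp: P_def)
    then show "finite (Per (f ` P) S n)" "card (Per (f ` P) S n) = v n"
      using n fin crd by (simp_all add: Per_eq card_image)
  qed
  then show ?thesis by (auto simp: realisable_def)
qed

text \<open>
  Sequences $(u_n)_{n \geq 1}$ are functions on \<open>nat\<close> with the unused entry at \<open>0\<close> fixed to be \<open>0\<close>, so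
  that each sequence is represented exactly once and dimensions are the intended ones. The
  recurrence is required only from \<open>n = 1\<close> on.
\<close>

definition rec_solutions :: "int \<Rightarrow> int \<Rightarrow> (nat \<Rightarrow> complex) set" where
  "rec_solutions B C = {u. u 0 = 0 \<and>
     (\<forall>n\<ge>1. u (n + 2) = of_int B * u (n + 1) - of_int C * u n)}"

definition realisable_solutions :: "int \<Rightarrow> int \<Rightarrow> (nat \<Rightarrow> complex) set" where
  "realisable_solutions B C = {u \<in> rec_solutions B C.
     \<exists>w :: nat \<Rightarrow> int. u = (\<lambda>n. of_int (w n)) \<and> realisable (\<lambda>n. nat \<bar>w n\<bar>)}"

definition seq_scale :: "complex \<Rightarrow> (nat \<Rightarrow> complex) \<Rightarrow> nat \<Rightarrow> complex" where
  "seq_scale c u = (\<lambda>n. c * u n)"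

global_interpretation cseq: vector_space seq_scale
  by unfold_locales (auto simp: seq_scale_def fun_eq_iff algebra_simps)

definition realisable_subspace :: "int \<Rightarrow> int \<Rightarrow> (nat \<Rightarrow> complex) set" where
  "realisable_subspace B C = cseq.span (realisable_solutions B C)"

text \<open>
  The library's \<open>dim\<close> is \<open>0\<close> on infinite-dimensional spaces. This does not interfere here: the
  solution space has dimension 2 and contains the realisable subspace.
\<close>

lemma subspace_rec_solutions: "cseq.subspace (rec_solutions B C)"
proof (rule cseq.subspaceI)
  fix c u assume u: "u \<in> rec_solutions B C"
  have "c * u (n + 2) = of_int B * (c * u (n + 1)) - of_int C * (c * u n)" if "n \<ge> 1" for n
  proof -
    have "u (n + 2) = of_int B * u (n + 1) - of_int C * u n"
      using u that unfolding rec_solutions_def by blast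
    then show ?thesis by (simp only: right_diff_distrib mult.left_commute)
  qed
  with u show "seq_scale c u \<in> rec_solutions B C"
    by (simp add: rec_solutions_def seq_scale_def)
qed (auto simp: rec_solutions_def algebra_simps)

lemma realisable_subspace_subset: "realisable_subspace B C \<subseteq> rec_solutions B C"
  unfolding realisable_subspace_def
  by (rule cseq.span_minimal[OF _ subspace_rec_solutions]) (auto simp: realisable_solutions_def)

fun basic_solution :: "int \<Rightarrow> int \<Rightarrow> complex \<Rightarrow> complex \<Rightarrow> nat \<Rightarrow> complex" where
  "basic_solution B C a b 0 = 0"
| "basic_solution B C a b (Suc 0) = a"
| "basic_solution B C a b (Suc (Suc 0)) = b"
| "basic_solution B C a b (Suc (Suc (Suc n))) =
     of_int B * basic_solution B C a b (Suc (Suc n)) - of_int C * basic_solution B C a b (Suc n)"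

lemma dim_rec_solutions: "cseq.dim (rec_solutions B C) = 2"
proof -
  define e where "e = basic_solution B C 1 0"
  define f where "f = basic_solution B C 0 1"
  have sol: "basic_solution B C a b \<in> rec_solutions B C" for a b
    unfolding rec_solutions_def
  proof (intro CollectI conjI allI impI)
    fix n :: nat assume "n \<ge> 1"
    then obtain m where "n = Suc m" by (cases n) auto
    then show "basic_solution B C a b (n + 2) =
      of_int B * basic_solution B C a b (n + 1) - of_int C * basic_solution B C a b n" by simp
  qed simp
  have vals: "e 1 = 1" "e 2 = 0" "f 1 = 0" "f 2 = 1"
    by (simp_all add: e_def f_def numeral_2_eq_2)
  have ne: "e \<noteq> f" using vals by auto
  have f0: "f \<noteq> 0" using vals(4) by (metis zero_fun_apply zero_neq_one)
  have "e \<notin> cseq.span {f}"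
  proof
    assume "e \<in> cseq.span {f}"
    then obtain k where "e = seq_scale k f" by (auto simp: cseq.span_singleton)
    then have "e 1 = k * f 1" by (simp add: seq_scale_def)
    with vals show False by simp
  qed
  then have ind: "cseq.independent {e, f}"
    using f0 ne by (simp add: cseq.independent_insert)
  have "u \<in> cseq.span {e, f}" if u: "u \<in> rec_solutions B C" for u
  proof -
    have "u n = u 1 * e n + u 2 * f n" for n
    proof (induction n rule: less_induct)
      case (less n)
      have "n = 0 \<or> n = 1 \<or> n = 2 \<or> n = Suc (Suc (Suc (n - 3)))" by linarith
      then consider "n = 0" | "n = 1" | "n = 2" | m where "n = Suc (Suc (Suc m))" by blast
      then show ?case
      proof cases
        case 4
        have "u (Suc m + 2) = of_int B * u (Suc m + 1) - of_int C * u (Suc m)"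
          using u unfolding rec_solutions_def by auto
        moreover have "u (Suc m) = u 1 * e (Suc m) + u 2 * f (Suc m)"
          "u (Suc (Suc m)) = u 1 * e (Suc (Suc m)) + u 2 * f (Suc (Suc m))"
          by (rule less; simp add: 4)+
        moreover have "e n = of_int B * e (Suc (Suc m)) - of_int C * e (Suc m)"
          "f n = of_int B * f (Suc (Suc m)) - of_int C * f (Suc m)"
          by (simp_all add: e_def f_def 4)
        ultimately show ?thesis using 4 by (simp add: ring_distribs mult_ac)
      qed (use vals u in \<open>simp_all add: rec_solutions_def e_def f_def\<close>)
    qed
    then have "u = seq_scale (u 1) e + seq_scale (u 2) f"
      unfolding seq_scale_def plus_fun_def by (rule ext)
    also have "\<dots> \<in> cseq.span {e, f}"
      by (intro cseq.span_add cseq.span_scale cseq.span_base) auto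
    finally show ?thesis .
  qed
  then have "cseq.dim (rec_solutions B C) = card {e, f}"
    using ind sol by (intro cseq.basis_card_eq_dim[symmetric]) (auto simp: e_def f_def)
  with ne show ?thesis by simp
qed

definition root_of_unity :: "complex \<Rightarrow> bool" where
  "root_of_unity z \<longleftrightarrow> (\<exists>k\<ge>1. z ^ k = 1)"

text \<open>
  For a double root the quotient is \<open>1\<close>, so the condition on the quotient is, as usual for linear
  recurrences, imposed on distinct roots only. The double root \<open>0\<close>, where the quotient is
  meaningless, is excluded. If exactly one root is \<open>0\<close>, the quotient is \<open>0\<close> (also when the
  denominator vanishes, as \<open>x / 0 = 0\<close>), which is not a root of unity.
\<close>

definition nondegenerate :: "complex \<Rightarrow> complex \<Rightarrow> bool" where
  "nondegenerate \<alpha>1 \<alpha>2 \<longleftrightarrow>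
     \<not> (\<alpha>1 = 0 \<and> \<alpha>2 = 0) \<and> (\<alpha>1 \<noteq> \<alpha>2 \<longrightarrow> \<not> root_of_unity (\<alpha>1 / \<alpha>2))"

end

theory Submission
  imports Defs "HOL-Number_Theory.Number_Theory"
begin

text \<open>
  Lower bounds. For $\Delta \geq 0$ and $B \geq 0$ there is a non-negative integer $2 \times 2$ matrix
  with trace $B$ and determinant $C$, and its edge shift has $V_n = \alpha_1^n + \alpha_2^n$ points of
  period $n$; the sign of $B$ disappears in $|V_n|$. Integer roots $x$ similarly give $|x|^n$.

  Upper bounds. If $|u|$ is realisable then $|u_{mp}| \equiv |u_m|$ modulo every prime $p$.
  \<^item> If $\Delta > 0$ is not a square, there are infinitely many primes $p$ at which $\Delta$ is a
    non-residue, and there $V_p \equiv B$, $U_p \equiv -1$. Writing $u$ as a combination of the Lucas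
    sequences $U$ and $V$, this leaves only multiples of $V$ or of $U$, and the latter are impossible since
    $U_p > 0$ for odd $p$. A double root is treated in the same way.
  \<^item> If $\Delta < 0$, take a large prime $p$ modulo which $f$ has a root. Then $u_{mp} \equiv u_m$
    modulo $p$, and $u_m$ modulo $p$ depends only on $m$ modulo $p - 1$. So, if $u \neq 0$, there is a
    residue class of $m$ modulo $p - 1$ on which $u_m$ and $u_{mp}$ always have the same sign. But
    $u_m = 2 \mathrm{Re}(a \alpha^m)$ with $\alpha / \bar\alpha$ not a root of unity, and
    averaging a trigonometric polynomial over the class shows that a sign change must occur.
\<close>

section \<open>Infinitely many inert primes\<close>

text \<open>By Euler's criterion both sides are congruent modulo \<open>p\<close>. They differ by at
  most 2, which is less than \<open>p\<close>, so they are equal.\<close>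

lemma Legendre_mult:
  assumes "prime p" "p > 2"
  shows "Legendre (a * b) (int p) = Legendre a (int p) * Legendre b (int p)"
proof -
  have "[Legendre (a * b) p = (a * b) ^ ((p - 1) div 2)] (mod p)"
    using euler_criterion assms by blast
  also have "(a * b) ^ ((p - 1) div 2) = a ^ ((p - 1) div 2) * b ^ ((p - 1) div 2)"
    by (simp add: power_mult_distrib)
  also have "[\<dots> = Legendre a p * Legendre b p] (mod p)"
    using euler_criterion assms by (intro cong_mult) (auto intro: cong_sym)
  finally have "int p dvd Legendre (a * b) p - Legendre a p * Legendre b p"
    by (simp add: cong_iff_dvd_diff)
  moreover have "\<bar>Legendre (a * b) p - Legendre a p * Legendre b p\<bar> \<le> 2"
    by (auto simp: Legendre_def)
  ultimately show ?thesis
    using assms(2) zdvd_imp_le[of "int p" "\<bar>Legendre (a * b) p - Legendre a p * Legendre b p\<bar>"]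
    by force
qed

lemma Legendre_cong: "[a = b] (mod p) \<Longrightarrow> Legendre a p = Legendre b p"
  by (simp add: Legendre_def QuadRes_def cong_def)

lemma Legendre_1: "p > 1 \<Longrightarrow> Legendre 1 p = 1"
  unfolding Legendre_def QuadRes_def
  by (auto simp: cong_def intro!: exI[of _ 1])

lemma Legendre_sq:
  assumes "prime p" "p > 2" "\<not> int p dvd a"
  shows "Legendre a p * Legendre a p = 1"
  using assms by (auto simp: Legendre_def cong_0_iff)

text \<open>Gauss's lemma with h = (p - 1) / 2: the doubles 2k with k \<le> h need no reduction
  modulo \<open>p\<close>, and those exceeding h are the ones with k > h / 2. The parity of their
  number depends only on \<open>p\<close> modulo 8.\<close>

lemma Legendre_two:
  fixes p :: nat
  assumes "prime p" "p > 2"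
  shows "Legendre 2 p = (if p mod 8 \<in> {1, 7} then 1 else -1)"
proof -
  have odd: "odd p" using assms prime_odd_nat by blast
  have "\<not> int p dvd 2" using assms zdvd_imp_le[of "int p" 2] by auto
  then interpret GAUSS p 2
    using assms by unfold_locales (auto simp: cong_0_iff)
  define h where "h = (int p - 1) div 2"
  have h: "int p = 2 * h + 1" using odd by (auto simp: h_def elim!: oddE)
  have hpos: "h > 0" using h assms by linarith
  have "C = (\<lambda>k. 2 * k) ` {0<..h}"
    unfolding C_def B_def A_def image_image h_def[symmetric]
    by (intro image_cong) (auto simp: h)
  then have "E = (\<lambda>k. 2 * k) ` {h div 2<..h}"
    unfolding E_def h_def[symmetric] using hpos by auto
  then have "card E = nat (h - h div 2)"
    by (simp add: card_image inj_on_def)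
  then have L: "Legendre 2 p = (-1) ^ nat (h - h div 2)"
    using gauss_lemma by simp
  have ev: "even (nat (h - h div 2)) \<longleftrightarrow> even (h - h div 2)"
    using hpos by (simp add: even_nat_iff)
  have "even (h - h div 2) \<longleftrightarrow> h mod 4 = 0 \<or> h mod 4 = 3" by presburger
  also have "\<dots> \<longleftrightarrow> int p mod 8 = 1 \<or> int p mod 8 = 7"
    unfolding h by presburger
  also have "\<dots> \<longleftrightarrow> p mod 8 \<in> {1, 7}"
    using zmod_int[of p 8] by auto
  finally show ?thesis using L ev by auto
qed

section \<open>Jacobi symbols and reciprocity\<close>

text \<open>The Jacobi symbol for odd \<open>N\<close>. Reciprocity computes it from residue classes
  of \<open>N\<close> alone, and the value -1 betrays a prime factor of \<open>N\<close> at which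
  \<open>a\<close> is a non-residue.\<close>

definition jacobi :: "int \<Rightarrow> nat \<Rightarrow> int" where
  "jacobi a N = (\<Prod>p\<in>#prime_factorization N. Legendre a (int p))"

lemma jacobi_mult:
  assumes "odd N"
  shows "jacobi (a * b) N = jacobi a N * jacobi b N"
proof -
  have "N > 0" using assms by (auto intro: Nat.gr0I)
  have "jacobi (a * b) N = (\<Prod>p\<in>#prime_factorization N. Legendre a (int p) * Legendre b (int p))"
    unfolding jacobi_def
  proof (intro arg_cong[of _ _ prod_mset] image_mset_cong)
    fix p assume "p \<in># prime_factorization N"
    then have "prime p" "p dvd N" by auto
    moreover have "p \<noteq> 2" using \<open>p dvd N\<close> assms by auto
    ultimately show "Legendre (a * b) (int p) = Legendre a (int p) * Legendre b (int p)"
      by (intro Legendre_mult) (use prime_ge_2_nat[of p] in auto)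
  qed
  then show ?thesis by (simp add: jacobi_def prod_mset.distrib)
qed

lemma jacobi_two:
  assumes "odd N"
  shows "jacobi 2 N = (if N mod 8 \<in> {1, 7} then 1 else -1)"
  using assms
proof (induction N rule: prime_divisors_induct)
  case (unit x)
  then show ?case by (simp add: jacobi_def)
next
  case (factor p x)
  then have "odd p" "odd x" by auto
  have "x \<noteq> 0" using \<open>odd x\<close> by (auto intro: Nat.gr0I)
  have "p > 2" using \<open>odd p\<close> \<open>prime p\<close> prime_ge_2_nat[of p] by (cases "p = 2") auto
  have "jacobi 2 (p * x) = Legendre 2 p * jacobi 2 x"
    using \<open>prime p\<close> \<open>x \<noteq> 0\<close> by (simp add: jacobi_def prime_factorization_mult prime_factorization_prime)
  also have "\<dots> = (if p mod 8 \<in> {1, 7} then 1 else -1) * (if x mod 8 \<in> {1, 7} then 1 else -1)"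
    using Legendre_two[OF \<open>prime p\<close> \<open>p > 2\<close>] factor.IH \<open>odd x\<close> by simp
  also have "\<dots> = (if (p mod 8) * (x mod 8) mod 8 \<in> {1, 7} then 1 else -1)"
  proof -
    have "n mod 8 = 1 \<or> n mod 8 = 3 \<or> n mod 8 = 5 \<or> n mod 8 = 7" if "odd n" for n :: nat
      using that by presburger
    from this[OF \<open>odd p\<close>] this[OF \<open>odd x\<close>] show ?thesis by auto
  qed
  finally show ?case by (simp add: mod_mult_eq)
qed auto

text \<open>Quadratic reciprocity, extended over the prime factors of \<open>N\<close>. The sign is
  multiplicative, since a product of two odd numbers is 3 modulo 4 exactly when one of the two
  is.\<close>

lemma jacobi_odd_prime:
  fixes q N :: nat
  assumes "prime q" "q > 2" "odd N" "\<not> q dvd N"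
  shows "jacobi q N = Legendre N q * (if q mod 4 = 3 \<and> N mod 4 = 3 then -1 else 1)"
  using assms(3,4)
proof (induction N rule: prime_divisors_induct)
  case (unit x)
  then show ?case using assms by (simp add: jacobi_def Legendre_1)
next
  case (factor p x)
  have "odd q" using assms(1,2) prime_odd_nat by blast
  from factor have "odd p" "odd x" "\<not> q dvd x" "\<not> q dvd p" by auto
  have "x \<noteq> 0" using \<open>odd x\<close> by (auto intro: Nat.gr0I)
  have "p > 2" using \<open>odd p\<close> \<open>prime p\<close> prime_ge_2_nat[of p] by (cases "p = 2") auto
  have "p \<noteq> q" using \<open>\<not> q dvd p\<close> by auto
  have sgn: "(-1::int) ^ ((p - 1) div 2 * ((q - 1) div 2)) = (if q mod 4 = 3 \<and> p mod 4 = 3 then -1 else 1)"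
  proof -
    have "odd ((p - 1) div 2) \<longleftrightarrow> p mod 4 = 3" using \<open>odd p\<close> by presburger
    moreover have "odd ((q - 1) div 2) \<longleftrightarrow> q mod 4 = 3" using \<open>odd q\<close> by presburger
    ultimately show ?thesis by (auto simp: minus_one_power_iff)
  qed
  have "Legendre p q * Legendre p q = 1"
    using Legendre_sq[OF assms(1,2)] \<open>\<not> q dvd p\<close> by simp
  \<comment> \<open>Reciprocity evaluates the product of the two symbols; multiplying by
    \<open>Legendre p q\<close>, whose square is 1, solves for \<open>Legendre q p\<close>.\<close>
  then have "Legendre q p = Legendre p q * (Legendre p q * Legendre q p)"
    by (simp flip: mult.assoc)
  also have "Legendre p q * Legendre q p = (if q mod 4 = 3 \<and> p mod 4 = 3 then -1 else 1)"
    using Quadratic_Reciprocity[OF \<open>prime p\<close> \<open>p > 2\<close> assms(1,2) \<open>p \<noteq> q\<close>] sgn by (rule trans)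
  finally have rec: "Legendre q p = Legendre p q * (if q mod 4 = 3 \<and> p mod 4 = 3 then -1 else 1)" .
  have "jacobi q (p * x) = Legendre q p * jacobi q x"
    using \<open>prime p\<close> \<open>x \<noteq> 0\<close> by (simp add: jacobi_def prime_factorization_mult prime_factorization_prime)
  also have "\<dots> = Legendre p q * Legendre x q *
     ((if q mod 4 = 3 \<and> p mod 4 = 3 then -1 else 1) * (if q mod 4 = 3 \<and> x mod 4 = 3 then -1 else 1))"
    using rec factor.IH \<open>odd x\<close> \<open>\<not> q dvd x\<close> by simp
  also have "Legendre p q * Legendre x q = Legendre (int (p * x)) q"
    using Legendre_mult[OF assms(1,2)] by simp
  also have "(if q mod 4 = 3 \<and> p mod 4 = 3 then -1 else 1) * (if q mod 4 = 3 \<and> x mod 4 = 3 then -1 else 1)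
     = (if q mod 4 = 3 \<and> (p mod 4) * (x mod 4) mod 4 = 3 then -1 else (1::int))"
  proof -
    have "n mod 4 = 1 \<or> n mod 4 = 3" if "odd n" for n :: nat
      using that by presburger
    from this[OF \<open>odd p\<close>] this[OF \<open>odd x\<close>] show ?thesis by auto
  qed
  finally show ?case by (simp add: mod_mult_eq)
qed auto

text \<open>Each prime factor of \<open>e\<close> contributes 1. For an odd prime q, reciprocity has
  no sign because \<open>N\<close> is 1 modulo 4, and \<open>N\<close> is the square 1 modulo q. The
  prime 2 needs the condition modulo 8.\<close>

lemma jacobi_eq_1:
  fixes e N :: nat
  assumes "e > 0" "N mod 4 = 1" "[N = 1] (mod e)" "even e \<Longrightarrow> N mod 8 = 1"
  shows "jacobi e N = 1"
  using assms(1,3,4)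
proof (induction e rule: prime_divisors_induct)
  case (unit x)
  have "N > 0" using assms(2) by (auto intro: Nat.gr0I)
  have "jacobi 1 N = 1" unfolding jacobi_def
    by (rule prod_mset.neutral) (auto intro!: Legendre_1 dest!: in_prime_factors_imp_prime prime_gt_1_nat)
  with unit show ?case by simp
next
  case (factor q e)
  have "odd N" using assms(2) by presburger
  have "[N = 1] (mod q)" "[N = 1] (mod e)"
    using factor.prems(2) by (auto elim: cong_dvd_modulus_nat)
  have "jacobi (int (q * e)) N = jacobi q N * jacobi e N"
    using jacobi_mult[OF \<open>odd N\<close>] by simp
  also have "jacobi e N = 1" using factor \<open>[N = 1] (mod e)\<close> by auto
  also have "jacobi q N = 1"
  proof (cases "q = 2")
    case True
    then show ?thesis using factor.prems jacobi_two[OF \<open>odd N\<close>] by simp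
  next
    case False
    then have "q > 2" using \<open>prime q\<close> prime_ge_2_nat[of q] by simp
    have "\<not> q dvd N"
      using \<open>[N = 1] (mod q)\<close> \<open>q > 2\<close> cong_dvd_iff[OF \<open>[N = 1] (mod q)\<close>] by auto
    then have "jacobi q N = Legendre N q"
      using jacobi_odd_prime[OF \<open>prime q\<close> \<open>q > 2\<close> \<open>odd N\<close>] assms(2) by simp
    also have "\<dots> = Legendre 1 q"
      using \<open>[N = 1] (mod q)\<close> by (intro Legendre_cong) (simp add: cong_int_iff[symmetric])
    finally show ?thesis using \<open>q > 2\<close> by (simp add: Legendre_1)
  qed
  finally show ?case by simp
qed auto

text \<open>Squaring identifies 1 and q - 1, so it is not injective on the finite set of residues,
  hence not surjective either. A missed value is a non-residue.\<close>

lemma ex_nonresidue: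
  fixes q :: nat
  assumes "prime q" "q > 2"
  obtains n :: nat where "Legendre (int n) (int q) = -1"
proof -
  define f where "f = (\<lambda>x::nat. x\<^sup>2 mod q)"
  have "f 1 = f (q - 1)"
  proof -
    have "[(int q - 1)\<^sup>2 = 1] (mod int q)"
      by (simp add: cong_iff_dvd_diff power2_eq_square algebra_simps)
    then have "[int ((q - 1)\<^sup>2) = int 1] (mod int q)"
      using assms by (simp add: of_nat_diff)
    then show ?thesis unfolding f_def cong_int_iff by (simp add: cong_def)
  qed
  then have "\<not> inj_on f {..<q}"
    using assms inj_onD[of f "{..<q}" 1 "q - 1"] by auto
  moreover have "f ` {..<q} \<subseteq> {..<q}" using assms by (auto simp: f_def)
  moreover have "f ` {..<q} \<noteq> {..<q}"
    using \<open>\<not> inj_on f {..<q}\<close> eq_card_imp_inj_on[of "{..<q}" f] by auto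
  ultimately obtain n where n: "n < q" "n \<notin> f ` {..<q}"
    by blast
  have "f 0 \<in> f ` {..<q}" using assms by auto
  then have "n \<noteq> 0" using n(2) by (auto simp: f_def)
  have "\<not> QuadRes q n"
  proof
    assume "QuadRes q n"
    then obtain y where y: "[y\<^sup>2 = int n] (mod q)" unfolding QuadRes_def by blast
    define x where "x = nat (y mod q)"
    have "x < q" using assms by (simp add: x_def nat_less_iff)
    have "[int (x\<^sup>2) = int n] (mod q)"
      using y assms by (simp add: x_def cong_def power_mod)
    then have "[x\<^sup>2 = n] (mod q)" by (simp only: cong_int_iff)
    then have "f x = n" using n by (simp add: f_def cong_def)
    then show False using n \<open>x < q\<close> by auto
  qed
  moreover have "\<not> [int n = 0] (mod q)" using \<open>n \<noteq> 0\<close> n(1) by (simp add: cong_def)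
  ultimately have "Legendre n q = -1" by (simp add: Legendre_def)
  then show thesis using that by blast
qed

lemma ex_prime_Legendre_neg:
  fixes N :: nat
  assumes "jacobi a N = -1"
  obtains p where "prime p" "p dvd N" "Legendre a (int p) = -1"
proof -
  have "\<exists>p\<in>#prime_factorization N. Legendre a (int p) = -1"
  proof (rule ccontr)
    assume "\<not> ?thesis"
    then have "\<forall>p\<in>#prime_factorization N. Legendre a (int p) \<ge> 0"
      by (auto simp: Legendre_def split: if_splits)
    moreover have "(\<Prod>p\<in>#A. Legendre a (int p)) \<ge> 0" if "\<forall>p\<in>#A. Legendre a (int p) \<ge> 0" for A
      using that by (induction A) auto
    ultimately have "jacobi a N \<ge> 0" unfolding jacobi_def by blast
    with assms show False by simp
  qed
  then show thesis using that by auto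
qed

text \<open>Write \<open>D\<close> as an odd power of a prime q times \<open>e\<close> with q not
  dividing \<open>e\<close>. The Chinese remainder theorem yields \<open>N\<close> with symbol -1
  for q and 1 for \<open>e\<close>, hence -1 for \<open>D\<close>, and some prime factor of
  \<open>N\<close> is as required.\<close>

theorem infinitely_many_inert_primes:
  fixes D M :: nat
  assumes "\<not> is_square D"
  obtains p where "prime p" "p > M" "p > 2" "Legendre (int D) (int p) = -1"
proof -
  have "D \<noteq> 0" using assms by (auto intro: Nat.gr0I)
  obtain q where q: "prime q" "odd (multiplicity q D)"
    using assms is_nth_power_conv_multiplicity_nat[of 2 D] \<open>D \<noteq> 0\<close> by auto
  obtain e where e: "D = q ^ multiplicity q D * e" "\<not> q dvd e"
    using multiplicity_decompose'[of D q] q \<open>D \<noteq> 0\<close>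
    by (metis not_prime_unit)
  have "e > 0" using e \<open>D \<noteq> 0\<close> by (auto intro: Nat.gr0I)
  have "e * fact M * 8 \<noteq> 0" using \<open>e > 0\<close> by simp
  \<comment> \<open>\<open>K\<close> is the part of \<open>e * fact M * 8\<close> prime to q.
    Removing q leaves the class of \<open>N\<close> modulo q (modulo 8 if q = 2) free to be
    prescribed.\<close>
  then obtain K where K: "e * fact M * 8 = q ^ multiplicity q (e * fact M * 8) * K" "\<not> q dvd K"
    using multiplicity_decompose'[of "e * fact M * 8" q] q by (metis not_prime_unit)
  have copK: "coprime (q ^ k) K" for k
    using q K by (auto intro!: coprime_power_left_iff[THEN iffD2] prime_imp_coprime)
  have dvdK: "x dvd K" if "x dvd e * fact M * 8" "\<not> q dvd x" for x
  proof -
    have "coprime x (q ^ multiplicity q (e * fact M * 8))"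
      using that(2) q(1) by (auto simp: coprime_commute intro: prime_imp_coprime)
    then show ?thesis using that(1) K(1) by (metis coprime_dvd_mult_right_iff)
  qed
  have "e dvd K" using e by (intro dvdK) auto
  \<comment> \<open>\<open>K\<close> is divisible by every prime up to \<open>M\<close> other than \<open>q\<close>, which forces the prime factors of \<open>N\<close>
    to be large.\<close>
  obtain N where N: "[N = 1] (mod K)" "N mod 4 = 1" "even e \<Longrightarrow> N mod 8 = 1" "jacobi q N = -1"
    "\<not> q dvd N"
  proof (cases "q = 2")
    case True
    \<comment> \<open>Here \<open>e\<close> is odd, so the condition modulo 8 is void, and the class
      5 modulo 8 is both 1 modulo 4 and a class where 2 has symbol -1.\<close>
    have "coprime 8 K" using copK[of 3] True by simp
    then obtain N where N: "[N = 5] (mod 8)" "[N = 1] (mod K)"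
      using binary_chinese_remainder_nat[of 8 K 5 1] by blast
    have N5: "N mod 8 = 5" using N(1) by (simp add: cong_def)
    then have N4: "N mod 4 = 1" by presburger
    have "odd N" using N5 by presburger
    then show ?thesis
      using that[of N] N N4 N5 e(2) jacobi_two[of N] True by simp
  next
    case False
    then have "q > 2" using q(1) prime_ge_2_nat[of q] by simp
    have "\<not> q dvd 8" 
      using q(1) False primes_dvd_imp_eq[of q 2] prime_dvd_power[of q 2 3] by auto
    then have "8 dvd K" by (intro dvdK) auto
    obtain n where n: "Legendre (int n) (int q) = -1"
      using ex_nonresidue[OF q(1) \<open>q > 2\<close>] .
    obtain N where N: "[N = n] (mod q)" "[N = 1] (mod K)"
      using binary_chinese_remainder_nat[of q K n 1] copK[of 1] by auto
    have "[N = 1] (mod 8)" using cong_dvd_modulus_nat[OF N(2) \<open>8 dvd K\<close>] .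
    then have N8: "N mod 8 = 1" by (simp add: cong_def)
    then have N4: "N mod 4 = 1" and "odd N" by presburger+
    have L: "Legendre N q = -1"
      using n N(1) Legendre_cong[of "int N" "int n" "int q"] by (simp add: cong_int_iff)
    have "\<not> q dvd N" 
    proof
      assume "q dvd N"
      then have "[int N = 0] (mod q)" by (simp add: cong_0_iff)
      with L show False by (simp add: Legendre_def)
    qed
    then show ?thesis
      using that[of N] N N4 N8 jacobi_odd_prime[OF q(1) \<open>q > 2\<close> \<open>odd N\<close>] L by simp
  qed
  have "odd N" using N(2) by presburger
  have jpow: "jacobi (int q ^ k) N = (-1) ^ k" for k
  proof (induction k)
    case 0
    then show ?case using jacobi_eq_1[of 1 N] N(2) by simp
  qed (simp add: jacobi_mult[OF \<open>odd N\<close>] N(4))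
  have "jacobi D N = jacobi (int q ^ multiplicity q D * int e) N"
    using e(1) by (metis of_nat_mult of_nat_power)
  also have "\<dots> = (-1) ^ multiplicity q D * jacobi e N"
    by (simp add: jacobi_mult[OF \<open>odd N\<close>] jpow)
  also have "\<dots> = -1"
    using jacobi_eq_1[OF \<open>e > 0\<close> N(2) cong_dvd_modulus_nat[OF N(1) \<open>e dvd K\<close>] N(3)] q(2) by simp
  finally obtain p where p: "prime p" "p dvd N" "Legendre D p = -1"
    by (rule ex_prime_Legendre_neg)
  have "p \<noteq> 2" using p(2) \<open>odd N\<close> by auto
  have "p \<noteq> q" using p(2) N(5) by auto
  have "p > M"
  proof (rule ccontr)
    assume "\<not> p > M"
    then have "p dvd fact M" using p(1) by (simp add: prime_dvd_fact_iff)
    then have "p dvd K"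
      using p(1) q(1) \<open>p \<noteq> q\<close> by (intro dvdK) (auto dest: primes_dvd_imp_eq)
    then have "[N = 1] (mod p)" using N(1) by (auto elim: cong_dvd_modulus_nat)
    then show False using p(1,2) cong_dvd_iff[of N 1 p] by auto
  qed
  moreover have "p > 2" using p(1) \<open>p \<noteq> 2\<close> prime_ge_2_nat[of p] by simp
  ultimately show thesis using that p by blast
qed

section \<open>Congruences for realisable sequences\<close>

lemma Per_mult_eq_fixed_points:
  "{x \<in> Per X T (m * p). (T ^^ m) x = x} = Per X T m"
proof -
  have "((T ^^ m) ^^ k) x = x" if "(T ^^ m) x = x" for k x
    using that by (induction k) auto
  then show ?thesis by (auto simp: Per_def funpow_mult)
qed

text \<open>\<open>S\<close> generates an action of the cyclic group of order \<open>p\<close> on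
  \<open>Y\<close>. The orbits of the points moved by \<open>S\<close> have exactly \<open>p\<close>
  elements and partition the set of these points.\<close>

lemma prime_dvd_card_nonfixed:
  assumes "prime p" "finite Y" "S ` Y \<subseteq> Y" "\<And>x. x \<in> Y \<Longrightarrow> (S ^^ p) x = x"
  shows "p dvd card {x \<in> Y. S x \<noteq> x}"
proof -
  define Z where "Z = {x \<in> Y. S x \<noteq> x}"
  define orb where "orb = (\<lambda>x. (\<lambda>i. (S ^^ i) x) ` {..<p})"
  have "p > 0" using assms(1) prime_gt_0_nat by blast
  have SY: "(S ^^ i) x \<in> Y" if "x \<in> Y" for i x
    using that assms(3) by (induction i) auto
  have Smod: "(S ^^ i) x = (S ^^ (i mod p)) x" if "x \<in> Y" for i x
    using funpow_mod_eq[OF assms(4)[OF that]] by metis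
  have orb_iff: "y \<in> orb x \<longleftrightarrow> (\<exists>i. y = (S ^^ i) x)" if "x \<in> Y" for x y
  proof
    assume "\<exists>i. y = (S ^^ i) x"
    then obtain i where "y = (S ^^ (i mod p)) x" using Smod[OF \<open>x \<in> Y\<close>] by auto
    then show "y \<in> orb x" using \<open>p > 0\<close> by (auto simp: orb_def)
  qed (auto simp: orb_def)
  have orb_Z: "orb x \<subseteq> Z" if "x \<in> Z" for x
  proof
    fix y assume "y \<in> orb x"
    then obtain i where i: "i < p" "y = (S ^^ i) x" by (auto simp: orb_def)
    have x: "x \<in> Y" "S x \<noteq> x" using that by (auto simp: Z_def)
    have cancel: "(S ^^ (p - i)) ((S ^^ i) z) = z" if "z \<in> Y" for z
      using assms(4)[OF that] i(1) funpow_add[of "p - i" i S] by simp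
    have "S y \<noteq> y"
    proof
      assume "S y = y"
      then have "(S ^^ i) (S x) = (S ^^ i) x" by (simp add: i(2) funpow_swap1)
      then show False using cancel[of x] cancel[of "S x"] x assms(3) by auto
    qed
    then show "y \<in> Z" using SY[OF x(1)] i(2) by (simp add: Z_def)
  qed
  have orb_sym: "x \<in> orb y" if xy: "x \<in> Z" "y \<in> orb x" for x y
  proof -
    obtain i where i: "i < p" "y = (S ^^ i) x" using xy by (auto simp: orb_def)
    have "x = (S ^^ (p - i)) y"
      using assms(4)[of x] xy i funpow_add[of "p - i" i S] by (simp add: Z_def)
    moreover have "y \<in> Y" using xy orb_Z by (auto simp: Z_def)
    ultimately show ?thesis using orb_iff by blast
  qed
  have tr: "orb y \<subseteq> orb x" if xy: "x \<in> Z" "y \<in> orb x" for x y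
  proof
    fix z assume "z \<in> orb y"
    have "x \<in> Y" "y \<in> Y" using xy orb_Z by (auto simp: Z_def)
    then obtain i j where "z = (S ^^ i) y" "y = (S ^^ j) x"
      using \<open>z \<in> orb y\<close> xy(2) orb_iff by blast
    then have "z = (S ^^ (i + j)) x" by (simp add: funpow_add)
    then show "z \<in> orb x" using orb_iff \<open>x \<in> Y\<close> by blast
  qed
  have card_orb: "card (orb x) = p" if "x \<in> Z" for x
  proof -
    have x: "x \<in> Y" "S x \<noteq> x" using that by (auto simp: Z_def)
    have "inj_on (\<lambda>i. (S ^^ i) x) {..<p}"
    proof (rule linorder_inj_onI)
      fix i j assume ij: "i < j" "i \<in> {..<p}" "j \<in> {..<p}"
      show "(S ^^ i) x \<noteq> (S ^^ j) x"
      proof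
        assume "(S ^^ i) x = (S ^^ j) x"
        then have "(S ^^ (p - i + i)) x = (S ^^ (p - i + j)) x"
          by (simp only: funpow_add o_apply)
        also have "p - i + i = p" using ij by auto
        also have "p - i + j = (j - i) + p" using ij by auto
        finally have fix1: "(S ^^ (j - i)) x = x"
          unfolding funpow_add o_apply assms(4)[OF x(1)] by (rule sym)
        have fixk: "(S ^^ (k * (j - i))) x = x" for k
          by (induction k) (simp_all add: funpow_add fix1)
        \<comment> \<open>As j - i is invertible modulo \<open>p\<close>, some multiple of it is 1
          modulo \<open>p\<close>; a point fixed by the iterate of order j - i is then fixed by
          \<open>S\<close>.\<close>
        have "\<not> p dvd j - i" using ij nat_dvd_not_less[of "j - i" p] by auto
        then have "coprime (j - i) p"
          using assms(1) prime_imp_coprime_nat coprime_commute by blast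
        then obtain k where "[(j - i) * k = 1] (mod p)"
          using cong_solve_coprime_nat[of "j - i" p] by auto
        then have k: "k * (j - i) mod p = 1"
          using prime_gt_1_nat[OF assms(1)] by (simp add: cong_def mult.commute[of k])
        have "(S ^^ (k * (j - i))) x = S x"
          using Smod[OF x(1), of "k * (j - i)"] k by simp
        with fixk x(2) show False by simp
      qed
    qed auto
    then show ?thesis by (simp add: orb_def card_image)
  qed
  have self: "x \<in> orb x" for x
    using \<open>p > 0\<close> by (auto simp: orb_def intro!: image_eqI[of _ _ 0])
  have un: "\<Union> (orb ` Z) = Z" using orb_Z self by blast
  have "p dvd card (\<Union> (orb ` Z))"
  proof (rule dvd_partition)
    show "finite (\<Union> (orb ` Z))" using un assms(2) by (simp add: Z_def)
    show "\<forall>c\<in>orb ` Z. p dvd card c" using card_orb by auto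
    show "\<forall>c1\<in>orb ` Z. \<forall>c2\<in>orb ` Z. c1 \<noteq> c2 \<longrightarrow> c1 \<inter> c2 = {}"
    proof (clarify, rule ccontr)
      fix x y assume xy: "x \<in> Z" "y \<in> Z" "orb x \<noteq> orb y" "orb x \<inter> orb y \<noteq> {}"
      then obtain z where z: "z \<in> orb x" "z \<in> orb y" by blast
      have "z \<in> Z" using z xy orb_Z by blast
      have "orb z = orb x" "orb z = orb y"
        using tr orb_sym z xy \<open>z \<in> Z\<close> by (meson subset_antisym)+
      with xy show False by simp
    qed
  qed
  then show ?thesis unfolding un by (simp add: Z_def)
qed

text \<open>On the points of period m p, the map \<open>T ^^ m\<close> has \<open>p\<close>-th
  iterate the identity, and its fixed points are those of period m. The remaining points come in
  orbits of size \<open>p\<close>.\<close>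

lemma realisable_cong_prime:
  assumes "realisable v" "prime p" "m \<ge> 1"
  shows "[v (m * p) = v m] (mod p)"
proof -
  obtain X :: "nat set" and T where XT: "T ` X \<subseteq> X"
    and v: "\<And>n. n \<ge> 1 \<Longrightarrow> finite (Per X T n) \<and> card (Per X T n) = v n"
    using assms(1) by (auto simp: realisable_def realises_def)
  define Y where "Y = Per X T (m * p)"
  have mp: "m * p \<ge> 1" using assms prime_gt_0_nat[of p] by (simp add: Suc_le_eq)
  have fin: "finite Y" using v mp by (simp add: Y_def)
  have TX: "(T ^^ i) x \<in> X" if "x \<in> X" for i x
    using that XT by (induction i) auto
  have "p dvd card {x \<in> Y. (T ^^ m) x \<noteq> x}"
  proof (rule prime_dvd_card_nonfixed[OF assms(2) fin])
    show "(T ^^ m) ` Y \<subseteq> Y"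
    proof
      fix y assume "y \<in> (T ^^ m) ` Y"
      then obtain x where x: "x \<in> X" "(T ^^ (m * p)) x = x" "y = (T ^^ m) x"
        by (auto simp: Y_def Per_def)
      have "(T ^^ (m * p)) ((T ^^ m) x) = (T ^^ m) ((T ^^ (m * p)) x)"
        by (metis add.commute comp_apply funpow_add)
      then show "y \<in> Y" using x TX by (simp add: Y_def Per_def)
    qed
    show "((T ^^ m) ^^ p) x = x" if "x \<in> Y" for x
      using that by (simp add: Y_def Per_def funpow_mult)
  qed
  moreover have "card Y = card (Per X T m) + card {x \<in> Y. (T ^^ m) x \<noteq> x}"
  proof -
    have "Y = {x \<in> Y. (T ^^ m) x = x} \<union> {x \<in> Y. (T ^^ m) x \<noteq> x}" by auto
    then have "card Y = card {x \<in> Y. (T ^^ m) x = x} + card {x \<in> Y. (T ^^ m) x \<noteq> x}"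
      using fin by (subst card_Un_disjoint[symmetric]) auto
    then show ?thesis by (simp add: Y_def Per_mult_eq_fixed_points)
  qed
  ultimately have "p dvd card Y - card (Per X T m)" "card (Per X T m) \<le> card Y" by auto
  then show ?thesis using v mp assms(3) by (simp add: Y_def cong_altdef_nat)
qed

section \<open>Periodic points of edge shifts\<close>

text \<open>An edge is a triple of source, target and an index below the corresponding entry of
  \<open>A\<close>, so \<open>A\<close> is the adjacency matrix of a directed multigraph.\<close>

fun edge_path :: "('v \<Rightarrow> 'v \<Rightarrow> nat) \<Rightarrow> 'v \<Rightarrow> ('v \<times> 'v \<times> nat) list \<Rightarrow> 'v \<Rightarrow> bool" where
  "edge_path A i [] j \<longleftrightarrow> i = j"
| "edge_path A i (e # es) j \<longleftrightarrow> fst e = i \<and> snd (snd e) < A i (fst (snd e)) \<and> edge_path A (fst (snd e)) es j"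

text \<open>The (i, j) entry of the n-th power of the matrix \<open>A\<close>.\<close>

fun path_count :: "('v::finite \<Rightarrow> 'v \<Rightarrow> nat) \<Rightarrow> nat \<Rightarrow> 'v \<Rightarrow> 'v \<Rightarrow> nat" where
  "path_count A 0 i j = (if i = j then 1 else 0)"
| "path_count A (Suc n) i j = (\<Sum>t\<in>UNIV. A i t * path_count A n t j)"

lemma card_edge_paths:
  fixes A :: "'v::finite \<Rightarrow> 'v \<Rightarrow> nat"
  shows "finite {es. length es = n \<and> edge_path A i es j} \<and>
    card {es. length es = n \<and> edge_path A i es j} = path_count A n i j"
proof (induction n arbitrary: i)
  case 0
  have "{es. length es = 0 \<and> edge_path A i es j} = (if i = j then {[]} else {})" by auto
  then show ?case by simp
next
  case (Suc n)
  define P where "P = (\<lambda>t. {es. length es = n \<and> edge_path A t es j})"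
  define Q where "Q = (SIGMA t:UNIV. {..<A i t} \<times> P t)"
  define f where "f = (\<lambda>(t :: 'v, k, es). (i, t, k::nat) # es)"
  have P: "finite (P t)" "card (P t) = path_count A n t j" for t
    using Suc[of t] by (auto simp: P_def)
  have "{es. length es = Suc n \<and> edge_path A i es j} = f ` Q"
  proof (intro equalityI subsetI)
    fix es assume "es \<in> {es. length es = Suc n \<and> edge_path A i es j}"
    then obtain e es' where e: "es = e # es'" "length es' = n" "edge_path A i (e # es') j"
      by (auto simp: length_Suc_conv)
    then have "es = f (fst (snd e), snd (snd e), es')"
      by (auto simp: f_def)
    moreover have "(fst (snd e), snd (snd e), es') \<in> Q" using e by (auto simp: Q_def P_def)
    ultimately show "es \<in> f ` Q" by (rule image_eqI)
  qed (auto simp: f_def Q_def P_def)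
  moreover have "inj_on f Q" by (auto simp: inj_on_def f_def)
  moreover have "finite Q" unfolding Q_def using P by (intro finite_SigmaI) auto
  moreover have "card Q = (\<Sum>t\<in>UNIV. card ({..<A i t} \<times> P t))"
    unfolding Q_def using P by (intro card_SigmaI) auto
  ultimately show ?case by (simp add: card_image card_cartesian_product P)
qed

text \<open>Local form of the recursive notion of path, as needed to repeat a closed path
  periodically.\<close>

lemma edge_path_nth:
  assumes "edge_path A i es j" "l < length es"
  shows "snd (snd (es ! l)) < A (fst (es ! l)) (fst (snd (es ! l)))"
    and "fst (snd (es ! l)) = (if Suc l < length es then fst (es ! Suc l) else j)"
    and "fst (es ! 0) = i"
  using assms
proof (induction es arbitrary: i l)
  case (Cons e es)
  { case 1 then show ?case using Cons by (cases l) auto }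
  { case 2 then show ?case using Cons by (cases l; cases es) auto }
  { case 3 then show ?case by simp }
qed auto

text \<open>A point of period n is the periodic repetition of its first n edges, which form a closed
  path, and every closed path of length n arises so. The count is the trace of the n-th power of
  \<open>A\<close>.\<close>

lemma edge_shift_realises:
  fixes A :: "'v::finite \<Rightarrow> 'v \<Rightarrow> nat"
  defines "X \<equiv> {x :: nat \<Rightarrow> 'v \<times> 'v \<times> nat. \<forall>i. snd (snd (x i)) < A (fst (x i)) (fst (snd (x i)))
      \<and> fst (snd (x i)) = fst (x (Suc i))}"
  shows "realises X (\<lambda>x i. x (Suc i)) (\<lambda>n. \<Sum>i\<in>UNIV. path_count A n i i)"
proof -
  define T where "T = (\<lambda>(x :: nat \<Rightarrow> 'v \<times> 'v \<times> nat) i. x (Suc i))"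
  have Tn: "(T ^^ n) x = (\<lambda>i. x (i + n))" for n x
    by (induction n) (auto simp: T_def)
  have main: "finite (Per X T n) \<and> card (Per X T n) = (\<Sum>i\<in>UNIV. path_count A n i i)"
    if n: "n \<ge> 1" for n
  proof -
    define P where "P = (\<lambda>i. {es. length es = n \<and> edge_path A i es i})"
    define F where "F = (\<lambda>x::nat \<Rightarrow> 'v \<times> 'v \<times> nat. map x [0..<n])"
    have PerD: "x (l + n) = x l" if "x \<in> Per X T n" for x l
      using that by (auto simp: Per_def Tn fun_eq_iff)
    have Permod: "x l = x (l mod n)" if "x \<in> Per X T n" for x l
    proof -
      have "x (k * n + r) = x r" for k r
      proof (induction k)
        case (Suc k)
        have "x (Suc k * n + r) = x (k * n + r + n)" by (simp add: algebra_simps)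
        then show ?case using Suc PerD[OF that] by simp
      qed simp
      from this[of "l div n" "l mod n"] show ?thesis by simp
    qed
    have inj: "inj_on F (Per X T n)"
    proof (rule inj_onI)
      fix x y assume xy: "x \<in> Per X T n" "y \<in> Per X T n" "F x = F y"
      then have "x l = y l" if "l < n" for l
        using that by (auto simp: F_def)
      then have "x (l mod n) = y (l mod n)" for l using n by simp
      then show "x = y" using Permod xy by (metis ext)
    qed
    have "F ` Per X T n = (\<Union>i. P i)"
    proof (intro equalityI subsetI)
      fix es assume "es \<in> F ` Per X T n"
      then obtain x where x: "x \<in> Per X T n" "es = F x" by blast
      then have xX: "x \<in> X" by (simp add: Per_def)
      have "edge_path A (fst (x k)) (map x [k..<k + m]) (fst (x (k + m)))" for k m
      proof (induction m arbitrary: k)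
        case (Suc m)
        have "[k..<k + Suc m] = k # [Suc k..<Suc k + m]"
          by (subst upt_conv_Cons) auto
        moreover have "snd (snd (x k)) < A (fst (x k)) (fst (snd (x k)))"
          using xX unfolding X_def by blast
        moreover have "fst (snd (x k)) = fst (x (Suc k))"
          using xX unfolding X_def by blast
        ultimately show ?case using Suc[of "Suc k"] by simp
      qed simp
      from this[of 0 n] PerD[OF x(1), of 0] show "es \<in> (\<Union>i. P i)"
        by (auto simp: P_def F_def x(2))
    next
      fix es assume "es \<in> (\<Union>i. P i)"
      then obtain i where es: "length es = n" "edge_path A i es i" by (auto simp: P_def)
      define x where "x = (\<lambda>l. es ! (l mod n))"
      have "x \<in> X"
        unfolding X_def
      proof (intro CollectI allI conjI)
        fix l
        have l: "l mod n < length es" using n es by simp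
        show "snd (snd (x l)) < A (fst (x l)) (fst (snd (x l)))"
          unfolding x_def by (rule edge_path_nth(1)[OF es(2) l])
        show "fst (snd (x l)) = fst (x (Suc l))"
          \<comment> \<open>At the last edge of the block the next edge is the first one again; they
            match because the path is closed.\<close>
          using edge_path_nth(2)[OF es(2) l] edge_path_nth(3)[OF es(2) l] es(1) l
          by (cases "Suc (l mod n) = n") (simp_all add: x_def mod_Suc)
      qed
      then have "x \<in> Per X T n" by (simp add: Per_def Tn x_def)
      moreover have "F x = es" unfolding F_def x_def using es(1)
        by (intro nth_equalityI) auto
      ultimately show "es \<in> F ` Per X T n" by blast
    qed
    moreover have "finite (\<Union>i. P i)" unfolding P_def using card_edge_paths by auto
    moreover have "card (\<Union>i. P i) = (\<Sum>i\<in>UNIV. card (P i))"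
    proof (rule card_UN_disjoint)
      show "\<forall>i\<in>UNIV. \<forall>j\<in>UNIV. i \<noteq> j \<longrightarrow> P i \<inter> P j = {}"
      proof (intro ballI impI equals0I)
        fix i j es assume ij: "i \<noteq> j" "es \<in> P i \<inter> P j"
        then have "0 < length es" "0 < n" using n by (auto simp: P_def)
        then show False using ij edge_path_nth(3)[of A i es i 0] edge_path_nth(3)[of A j es j 0]
          by (simp add: P_def)
      qed
    qed (use card_edge_paths in \<open>auto simp: P_def\<close>)
    moreover have "card (P i) = path_count A n i i" for i
      using card_edge_paths[of n A i i] by (simp add: P_def)
    ultimately show ?thesis
      using card_image[OF inj] finite_image_iff[OF inj] by simp
  qed
  have "T ` X \<subseteq> X" by (auto simp: X_def T_def)
  then show ?thesis using main unfolding realises_def T_def by blast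
qed

text \<open>The Lucas sequence of the second kind, the sum of the n-th powers of the two
  roots.\<close>

fun lucas_V :: "int \<Rightarrow> int \<Rightarrow> nat \<Rightarrow> int" where
  "lucas_V B C 0 = 2"
| "lucas_V B C (Suc 0) = B"
| "lucas_V B C (Suc (Suc n)) = B * lucas_V B C (Suc n) - C * lucas_V B C n"

text \<open>By Cayley-Hamilton the traces of the powers of a 2 by 2 matrix satisfy the recurrence
  given by its trace and determinant.\<close>

lemma path_count_trace:
  fixes A :: "bool \<Rightarrow> bool \<Rightarrow> nat"
  shows "int (\<Sum>i\<in>UNIV. path_count A n i i) =
    lucas_V (A False False + A True True)
      (int (A False False) * A True True - int (A False True) * A True False) n"
proof (induction n rule: induct_nat_012)
  case 0
  then show ?case by (simp add: UNIV_bool)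
next
  case 1
  then show ?case by (simp add: UNIV_bool)
next
  case (ge2 n)
  have "int (\<Sum>i\<in>UNIV. path_count A (Suc (Suc n)) i i) =
      (A False False + A True True) * int (\<Sum>i\<in>UNIV. path_count A (Suc n) i i) -
      (int (A False False) * A True True - int (A False True) * A True False) *
        int (\<Sum>i\<in>UNIV. path_count A n i i)"
    by (simp add: UNIV_bool algebra_simps)
  then show ?case by (simp only: ge2 lucas_V.simps)
qed

lemma lucas_V_realisable:
  assumes "B \<ge> 0" "B\<^sup>2 - 4 * C \<ge> 0"
  shows "lucas_V B C n \<ge> 0" "realisable (\<lambda>n. nat (lucas_V B C n))"
proof -
  \<comment> \<open>The matrix has diagonal \<open>a\<close>, \<open>d\<close> and off-diagonal
    entries 1, \<open>b\<close>. Halving \<open>B\<close> as evenly as possible makes a d large: 4 b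
    \<ge> -1, and \<open>b\<close> is an integer, so b \<ge> 0.\<close>
  define a d where "a = B div 2" and "d = B - a"
  define b where "b = a * d - C"
  have "4 * (a * d) \<ge> B\<^sup>2 - 1"
  proof (cases "even B")
    case True
    then obtain k where "B = 2 * k" by auto
    then show ?thesis by (simp add: a_def d_def power2_eq_square)
  next
    case False
    then obtain k where "B = 2 * k + 1" by (auto elim: oddE)
    then show ?thesis by (simp add: a_def d_def power2_eq_square algebra_simps)
  qed
  then have "b \<ge> 0" using assms by (simp add: b_def)
  have "a \<ge> 0" "d \<ge> 0" using assms by (auto simp: a_def d_def)
  define A where "A = (\<lambda>i j. if i then (if j then nat d else nat b) else (if j then 1 else nat a))"
  have eq: "int (\<Sum>i\<in>UNIV. path_count A n i i) = lucas_V B C n" for n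
    using path_count_trace[of A n] \<open>a \<ge> 0\<close> \<open>b \<ge> 0\<close> \<open>d \<ge> 0\<close>
    by (simp add: A_def b_def d_def)
  then show "lucas_V B C n \<ge> 0" by (metis of_nat_0_le_iff)
  have "nat (lucas_V B C n) = (\<Sum>i\<in>UNIV. path_count A n i i)" for n
    using eq[of n] by linarith
  then show "realisable (\<lambda>n. nat (lucas_V B C n))"
    using realises_imp_realisable[OF edge_shift_realises[of A]] by simp
qed

section \<open>Negative discriminant: congruences and sign changes\<close>

text \<open>Integer analogue of \<open>rec_solutions\<close> with the entry at 0 left free, so that
  Lucas sequences and powers qualify unchanged.\<close>

definition recurrent :: "int \<Rightarrow> int \<Rightarrow> (nat \<Rightarrow> int) \<Rightarrow> bool" where
  "recurrent B C w \<longleftrightarrow> (\<forall>n\<ge>1. w (n + 2) = B * w (n + 1) - C * w n)"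

lemma recurrent_step:
  "recurrent B C w \<Longrightarrow> w (Suc (Suc (Suc n))) = B * w (Suc (Suc n)) - C * w (Suc n)"
  unfolding recurrent_def by (metis Suc_eq_plus1 add_2_eq_Suc' le_add2)

lemma fermat_theorem_int:
  fixes a :: int
  assumes "prime p" "\<not> int p dvd a"
  shows "[a ^ (p - 1) = 1] (mod int p)"
proof -
  have p: "p > 0" using assms(1) prime_gt_0_nat by blast
  define b where "b = nat (a mod int p)"
  have b: "int b = a mod int p" using p by (simp add: b_def)
  have "\<not> int p dvd int b" using assms(2) by (simp add: b dvd_mod_iff)
  then have "\<not> p dvd b" by simp
  then have "[b ^ (p - 1) = 1] (mod p)" using assms(1) fermat_theorem by blast
  then have "[int b ^ (p - 1) = 1] (mod int p)"
    by (metis cong_int_iff of_nat_1 of_nat_power)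
  then show ?thesis by (simp add: b cong_def power_mod)
qed

text \<open>The hypothesis makes s a root of the characteristic polynomial modulo q. Splitting off
  this root leaves a geometric sequence whose ratio is the other root B - s.\<close>

lemma recurrent_mod_root:
  assumes "recurrent B C w" "[s * (B - s) = C] (mod q)"
  shows "[w (Suc (Suc n)) - s * w (Suc n) = (B - s) ^ n * (w 2 - s * w 1)] (mod q)"
proof (induction n)
  case 0
  then show ?case by (simp add: numeral_2_eq_2)
next
  case (Suc n)
  have "w (Suc (Suc (Suc n))) - s * w (Suc (Suc n)) =
     (B - s) * (w (Suc (Suc n)) - s * w (Suc n)) + (s * (B - s) - C) * w (Suc n)"
    by (simp add: recurrent_step[OF assms(1)] algebra_simps)
  also have "[\<dots> = (B - s) * ((B - s) ^ n * (w 2 - s * w 1)) + 0 * w (Suc n)] (mod q)"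
    by (intro cong_add cong_mult cong_refl Suc cong_diff_iff_cong_0[THEN iffD2] assms(2))
  finally show ?case by (simp add: mult.assoc)
qed

text \<open>Modulo \<open>p\<close> both roots are units, as their product is C, so by Fermat their
  powers have period p - 1. The difference of the roots can be cancelled because its square is the
  discriminant.\<close>

lemma recurrent_split_prime_periodic:
  fixes p :: nat
  assumes w: "recurrent B C w" and p: "prime p" and s: "[s * (B - s) = C] (mod int p)"
    and C: "\<not> int p dvd C" and disc: "\<not> int p dvd B\<^sup>2 - 4 * C" and n: "n \<ge> 1"
  shows "[w (n + k * (p - 1)) = w n] (mod int p)"
proof -
  define t where "t = B - s"
  obtain l where l: "n = Suc l" using n by (cases n) auto
  have st: "[s * t = C] (mod int p)" using s by (simp add: t_def)
  then have t: "[t * (B - t) = C] (mod int p)" by (simp add: t_def mult.commute)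
  have "\<not> int p dvd s * t" using st C cong_dvd_iff by blast
  then have pst: "\<not> int p dvd s" "\<not> int p dvd t" by auto
  \<comment> \<open>Subtracting the geometric relations for the two roots eliminates the term at i +
    2.\<close>
  have f: "[(t - s) * w (Suc i) = t ^ i * (w 2 - s * w 1) - s ^ i * (w 2 - t * w 1)] (mod int p)" for i
    using cong_diff[OF recurrent_mod_root[OF w s, of i] recurrent_mod_root[OF w t, of i]]
    by (simp add: t_def algebra_simps)
  have per: "[x ^ (l + k * (p - 1)) = x ^ l] (mod int p)" if "\<not> int p dvd x" for x
  proof -
    have "[x ^ l * (x ^ (p - 1)) ^ k = x ^ l * 1 ^ k] (mod int p)"
      using fermat_theorem_int[OF p that] by (intro cong_mult cong_pow cong_refl)
    then show ?thesis by (simp add: power_add mult.commute[of k] power_mult)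
  qed
  have "[(t - s) * w (Suc (l + k * (p - 1))) = t ^ l * (w 2 - s * w 1) - s ^ l * (w 2 - t * w 1)] (mod int p)"
    using f by (rule cong_trans) (intro cong_diff cong_mult cong_refl per pst)
  then have "[(t - s) * w (Suc (l + k * (p - 1))) = (t - s) * w (Suc l)] (mod int p)"
    using cong_sym[OF f] by (rule cong_trans)
  then have "int p dvd (t - s) * (w (n + k * (p - 1)) - w n)"
    by (simp add: l cong_iff_dvd_diff algebra_simps)
  moreover have "\<not> int p dvd t - s"
  proof
    assume "int p dvd t - s"
    then have "int p dvd (t - s)\<^sup>2" by (simp add: power2_eq_square)
    moreover have "(t - s)\<^sup>2 = B\<^sup>2 - 4 * C - 4 * (s * t - C)"
      by (simp add: t_def power2_eq_square algebra_simps)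
    moreover have "int p dvd 4 * (s * t - C)" using st by (intro dvd_mult) (simp add: cong_iff_dvd_diff)
    ultimately have "int p dvd B\<^sup>2 - 4 * C" by (metis zdvd_zdiffD)
    then show False using disc by contradiction
  qed
  ultimately show ?thesis
    using p by (simp add: cong_iff_dvd_diff prime_dvd_mult_iff)
qed

text \<open>Euclid's argument applied to a value of the polynomial. The sign \<open>k\<close> makes
  the linear term non-negative, so that r > 1 and r has a prime factor.\<close>

lemma ex_split_prime:
  fixes B C :: int and M :: nat
  assumes "C > 0"
  obtains p s where "prime p" "p > M" "[s * (B - s) = C] (mod int p)"
proof -
  define F :: int where "F = fact M"
  \<comment> \<open>At \<open>x = C * F * k\<close> the polynomial \<open>x\<^sup>2 - B * x + C\<close> equals \<open>C * r\<close>, and \<open>r\<close> is congruent to 1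
    modulo every prime up to \<open>M\<close>.\<close>
  define k :: int where "k = (if B \<le> 0 then 1 else -1)"
  define r where "r = C * F\<^sup>2 + \<bar>B\<bar> * F + 1"
  have "F > 0" by (simp add: F_def)
  then have "C * F\<^sup>2 > 0" "\<bar>B\<bar> * F \<ge> 0" using assms by auto
  then have "nat r \<noteq> 1" by (simp add: r_def)
  then obtain p where p: "prime p" "p dvd nat r" using prime_factor_nat by blast
  have pr: "int p dvd r" using p(2) \<open>C * F\<^sup>2 > 0\<close> \<open>\<bar>B\<bar> * F \<ge> 0\<close>
    by (simp add: r_def int_dvd_int_iff[symmetric])
  have "p > M"
  proof (rule ccontr)
    assume "\<not> p > M"
    then have "p dvd fact M" using p(1) by (simp add: prime_dvd_fact_iff)
    then have "int p dvd F" unfolding F_def by (metis of_nat_dvd_iff of_nat_fact)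
    then have "int p dvd C * F\<^sup>2 + \<bar>B\<bar> * F" by (simp add: power2_eq_square)
    then have "int p dvd 1" using pr unfolding r_def by (meson dvd_add_right_iff)
    then show False using p(1) by auto
  qed
  moreover have "[(C * F * k) * (B - C * F * k) = C] (mod int p)"
  proof -
    have "(C * F * k) * (B - C * F * k) - C = - (C * r)"
      by (simp add: r_def k_def power2_eq_square algebra_simps)
    then show ?thesis using pr by (simp add: cong_iff_dvd_diff)
  qed
  ultimately show thesis using that p(1) by blast
qed

section \<open>Sign changes by averaging trigonometric sums\<close>

text \<open>A strong form of having mean value zero that is stable under addition.\<close>

definition bounded_sums :: "(nat \<Rightarrow> complex) \<Rightarrow> bool" where
  "bounded_sums f \<longleftrightarrow> (\<exists>K. \<forall>n. norm (\<Sum>j<n. f j) \<le> K)"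

lemma bounded_sums_add:
  assumes "bounded_sums f" "bounded_sums g"
  shows "bounded_sums (\<lambda>j. f j + g j)"
proof -
  obtain K L where "norm (\<Sum>j<n. f j) \<le> K" "norm (\<Sum>j<n. g j) \<le> L" for n
    using assms unfolding bounded_sums_def by blast
  then have "norm (\<Sum>j<n. f j + g j) \<le> K + L" for n
    unfolding sum.distrib by (meson add_mono norm_triangle_ineq order_trans)
  then show ?thesis unfolding bounded_sums_def by blast
qed

lemma bounded_sums_geometric:
  assumes "norm z = 1" "z \<noteq> 1"
  shows "bounded_sums (\<lambda>j. c * z ^ j)"
proof -
  have "norm (\<Sum>j<n. c * z ^ j) \<le> norm c * (2 / norm (1 - z))" for n
  proof -
    have "(\<Sum>j<n. c * z ^ j) = c * ((1 - z ^ n) / (1 - z))"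
      using assms(2) by (simp add: sum_distrib_left[symmetric] sum_gp_strict)
    moreover have "norm (1 - z ^ n) \<le> 2"
      using norm_triangle_ineq4[of 1 "z ^ n"] assms(1) by (simp add: norm_power)
    ultimately show ?thesis
      by (simp add: norm_mult norm_divide divide_right_mono mult_left_mono)
  qed
  then show ?thesis unfolding bounded_sums_def by blast
qed

text \<open>The mean of f is zero, so the mean of h is -d, and h is non-negative.\<close>

lemma bounded_sums_mean_nonneg:
  assumes "bounded_sums f" "\<And>j. 0 \<le> h j" "\<And>j. complex_of_real (h j) = f j - of_real d"
  shows "d \<le> 0"
proof (rule ccontr)
  assume "\<not> d \<le> 0"
  obtain K where K: "norm (\<Sum>j<n. f j) \<le> K" for n
    using assms(1) unfolding bounded_sums_def by blast
  have "of_nat n * d \<le> K" for n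
  proof -
    have "(\<Sum>j<n. f j) = complex_of_real ((\<Sum>j<n. h j) + of_nat n * d)"
      by (simp add: assms(3) sum_subtractf)
    moreover have "(\<Sum>j<n. h j) \<ge> 0" by (intro sum_nonneg assms)
    ultimately show ?thesis
      using K[of n] \<open>\<not> d \<le> 0\<close> by (simp add: norm_of_real del: of_real_add of_real_mult)
  qed
  then show False using \<open>\<not> d \<le> 0\<close> reals_Archimedean3[of d] by (meson not_le)
qed

text \<open>Along the progression this is a geometric sequence with ratio z^(q k), which is not
  1.\<close>

lemma bounded_sums_rotation:
  assumes "norm z = 1" "\<And>k. k \<ge> 1 \<Longrightarrow> z ^ k \<noteq> 1" "q \<ge> 1" "k \<ge> 1"
  shows "bounded_sums (\<lambda>j. c * (z ^ (m + q * j)) ^ k)"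
proof -
  have "bounded_sums (\<lambda>j. (c * z ^ (m * k)) * (z ^ (q * k)) ^ j)"
    using assms by (intro bounded_sums_geometric) (auto simp: norm_power)
  moreover have "(c * z ^ (m * k)) * (z ^ (q * k)) ^ j = c * (z ^ (m + q * j)) ^ k" for j
    by (simp add: power_add[symmetric] power_mult[symmetric] algebra_simps)
  ultimately show ?thesis by simp
qed

text \<open>Scale \<alpha> to a unit number z. Without a sign change, the product of the two terms
  times a suitable non-negative weight is a non-negative trigonometric polynomial in z^(m + q j).
  Its constant term is -2 |a|^2, and every other frequency averages out because z is not a root of
  unity.\<close>

lemma conjugate_sum_changes_sign:
  fixes a \<alpha> :: complex and w :: "nat \<Rightarrow> real"
  assumes w: "\<And>n. n \<ge> 1 \<Longrightarrow> of_real (w n) = a * \<alpha> ^ n + cnj a * cnj \<alpha> ^ n"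
    and a: "a \<noteq> 0" and \<alpha>: "\<alpha> \<noteq> 0" and ratio: "\<And>k. k \<ge> 1 \<Longrightarrow> (\<alpha> / cnj \<alpha>) ^ k \<noteq> 1"
    and q: "q \<ge> 1" and m: "m \<ge> 1"
  obtains j where "w (m + q * j) * w ((m + q * j) * Suc q) < 0"
proof (rule ccontr)
  assume "\<not> thesis"
  then have nonneg: "w (m + q * j) * w ((m + q * j) * Suc q) \<ge> 0" for j
    using that by (meson not_le)
  define \<rho> where "\<rho> = norm \<alpha>"
  define z where "z = \<alpha> / of_real \<rho>"
  have \<rho>: "\<rho> > 0" using \<alpha> by (simp add: \<rho>_def)
  have \<alpha>z: "\<alpha> = of_real \<rho> * z" using \<rho> by (simp add: z_def)
  have nz: "norm z = 1" using \<rho> by (simp add: z_def norm_divide \<rho>_def)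
  then have zz: "z * cnj z = 1" by (simp add: complex_norm_square[symmetric])
  have zk: "z ^ k \<noteq> 1" if "k \<ge> 1" for k
  proof
    assume z1: "z ^ k = 1"
    have "\<alpha> / cnj \<alpha> = z / cnj z" using \<rho> by (simp add: \<alpha>z)
    then have "(\<alpha> / cnj \<alpha>) ^ k = z ^ k / cnj (z ^ k)" by (simp add: power_divide)
    then show False using ratio[OF that] z1 by simp
  qed
  have czk: "cnj z ^ k \<noteq> 1" if "k \<ge> 1" for k
  proof
    assume "cnj z ^ k = 1"
    then have "cnj (cnj z ^ k) = 1" by simp
    then show False using zk[OF that] by simp
  qed
  define E where "E = (\<lambda>j. z ^ (m + q * j))"
  define F where "F = (\<lambda>j. cnj z ^ (m + q * j))"
  define v where "v = (\<lambda>n. w n / \<rho> ^ n)"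
  have v: "of_real (v n) = a * z ^ n + cnj a * cnj z ^ n" if "n \<ge> 1" for n
    using w[OF that] \<rho> by (simp add: v_def \<alpha>z power_mult_distrib field_simps)
  have EF: "E j * F j = 1" for j
    using zz by (simp add: E_def F_def power_mult_distrib[symmetric])
  \<comment> \<open>The last factor is non-negative but correlates negatively with the product of the first two,
    whose own mean is zero; the mean of \<open>h\<close> is therefore negative.\<close>
  define h where "h = (\<lambda>j. v (m + q * j) * v ((m + q * j) * Suc q) * (2 - 2 * Re (E j ^ q)))"
  \<comment> \<open>\<open>f\<close> is \<open>h\<close> without its constant term: only positive
    powers of \<open>E j\<close> and of its inverse \<open>F j\<close> occur.\<close>
  define f where "f = (\<lambda>j. 2 * a\<^sup>2 * E j ^ (q + 2) + (- a\<^sup>2) * E j ^ (2 * q + 2) + (- a\<^sup>2) * E j ^ 2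
     + 2 * a * cnj a * F j ^ q + (- a * cnj a) * F j ^ (2 * q)
     + 2 * a * cnj a * E j ^ q + (- a * cnj a) * E j ^ (2 * q)
     + 2 * (cnj a)\<^sup>2 * F j ^ (q + 2) + (- (cnj a)\<^sup>2) * F j ^ 2 + (- (cnj a)\<^sup>2) * F j ^ (2 * q + 2))"
  have "bounded_sums f"
    unfolding f_def E_def F_def using q nz
    by (intro bounded_sums_add bounded_sums_rotation zk czk) auto
  moreover have "h j \<ge> 0" for j
  proof -
    have "Re (E j ^ q) \<le> 1"
      using complex_Re_le_cmod[of "E j ^ q"] nz by (simp add: E_def norm_power)
    moreover have "v (m + q * j) * v ((m + q * j) * Suc q) \<ge> 0"
      using nonneg[of j] \<rho> by (simp add: v_def divide_nonneg_pos)
    ultimately show ?thesis by (simp add: h_def)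
  qed
  moreover have "complex_of_real (h j) = f j - of_real (2 * (norm a)\<^sup>2)" for j
  proof -
    define e g e' g' where "e = E j" and "g = E j ^ q" and "e' = F j" and "g' = F j ^ q"
    have ee: "e * e' = 1" using EF by (simp add: e_def e'_def)
    have gg: "g * g' = 1" using EF[of j] by (simp add: g_def g'_def power_mult_distrib[symmetric])
    have "cnj g = g'" by (simp add: g_def g'_def E_def F_def)
    then have g2: "complex_of_real (2 - 2 * Re (E j ^ q)) = 2 - g - g'"
      using complex_add_cnj[of g] unfolding g_def by (simp add: algebra_simps flip: g_def)
    have v1: "complex_of_real (v (m + q * j)) = a * e + cnj a * e'"
      using v[of "m + q * j"] m by (simp add: e_def e'_def E_def F_def)
    have v2: "complex_of_real (v ((m + q * j) * Suc q)) = a * (e * g) + cnj a * (e' * g')"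
    proof -
      have "complex_of_real (v ((m + q * j) * Suc q)) =
         a * z ^ ((m + q * j) * Suc q) + cnj a * cnj z ^ ((m + q * j) * Suc q)"
        using m by (intro v) auto
      also have "z ^ ((m + q * j) * Suc q) = e * g"
        unfolding power_mult by (simp add: e_def g_def E_def)
      also have "cnj z ^ ((m + q * j) * Suc q) = e' * g'"
        unfolding power_mult by (simp add: e'_def g'_def F_def)
      finally show ?thesis .
    qed
    have "complex_of_real (h j) = (a * e + cnj a * e') * (a * (e * g) + cnj a * (e' * g')) * (2 - g - g')"
      unfolding h_def of_real_mult g2 v1 v2 ..
    also have "\<dots> = (a\<^sup>2 * e\<^sup>2 * g + a * cnj a * (e * e') * (g + g') + (cnj a)\<^sup>2 * e'\<^sup>2 * g') * (2 - g - g')"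
      by (simp add: power2_eq_square algebra_simps)
    \<comment> \<open>The constant term stems from the summand with g * g' in the second line, once
      e * e' and g * g' are replaced by 1.\<close>
    also have "\<dots> = 2 * a\<^sup>2 * (e\<^sup>2 * g) - a\<^sup>2 * (e\<^sup>2 * g\<^sup>2) - a\<^sup>2 * e\<^sup>2 * (g * g')
       + a * cnj a * (e * e') * (2 * g + 2 * g' - g\<^sup>2 - g'\<^sup>2 - 2 * (g * g'))
       + 2 * (cnj a)\<^sup>2 * (e'\<^sup>2 * g') - (cnj a)\<^sup>2 * e'\<^sup>2 * (g * g') - (cnj a)\<^sup>2 * (e'\<^sup>2 * g'\<^sup>2)"
      by (simp add: power2_eq_square algebra_simps)
    also have "\<dots> = f j - 2 * (a * cnj a)"
    proof -
      have pw: "x ^ (2 * q) = (x ^ q)\<^sup>2" "x ^ (q + 2) = x\<^sup>2 * x ^ q"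
        "x ^ (2 * q + 2) = x\<^sup>2 * (x ^ q)\<^sup>2" for x :: complex
        unfolding power_add power_even_eq by (rule refl mult.commute)+
      have "E j ^ (q + 2) = e\<^sup>2 * g" "E j ^ (2 * q + 2) = e\<^sup>2 * g\<^sup>2" "E j ^ (2 * q) = g\<^sup>2"
        "F j ^ (q + 2) = e'\<^sup>2 * g'" "F j ^ (2 * q + 2) = e'\<^sup>2 * g'\<^sup>2" "F j ^ (2 * q) = g'\<^sup>2"
        unfolding e_def g_def e'_def g'_def by (rule pw)+
      then show ?thesis unfolding f_def
        by (simp only: ee gg) (simp add: e_def g_def e'_def g'_def algebra_simps)
    qed
    also have "2 * (a * cnj a) = complex_of_real (2 * (norm a)\<^sup>2)"
      by (simp only: of_real_mult complex_norm_square of_real_numeral)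
    finally show ?thesis .
  qed
  ultimately have "2 * (norm a)\<^sup>2 \<le> 0" by (rule bounded_sums_mean_nonneg)
  then show False using a by simp
qed

section \<open>Lucas sequences and positive discriminant\<close>

text \<open>The Lucas sequence of the first kind: for distinct roots, the difference of their n-th
  powers divided by the difference of the roots.\<close>

fun lucas_U :: "int \<Rightarrow> int \<Rightarrow> nat \<Rightarrow> int" where
  "lucas_U B C 0 = 0"
| "lucas_U B C (Suc 0) = 1"
| "lucas_U B C (Suc (Suc n)) = B * lucas_U B C (Suc n) - C * lucas_U B C n"

lemma recurrent_eqI:
  assumes "recurrent B C w" "recurrent B C w'" "w 1 = w' 1" "w 2 = w' 2" "n \<ge> 1"
  shows "w n = w' n"
proof -
  have "w (Suc n) = w' (Suc n)" for n
    using assms(3,4)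
    by (induction n rule: induct_nat_012)
      (simp_all add: recurrent_step[OF assms(1)] recurrent_step[OF assms(2)] numeral_2_eq_2)
  then show ?thesis using assms(5) by (cases n) auto
qed

lemma recurrent_lucas: "recurrent B C (lucas_V B C)" "recurrent B C (lucas_U B C)"
  by (auto simp: recurrent_def)

lemma recurrent_linear:
  assumes "recurrent B C w" "recurrent B C w'"
  shows "recurrent B C (\<lambda>n. a * w n + b * w' n)"
  unfolding recurrent_def
proof (intro allI impI)
  fix n :: nat assume "n \<ge> 1"
  with assms have "w (n + 2) = B * w (n + 1) - C * w n" "w' (n + 2) = B * w' (n + 1) - C * w' n"
    unfolding recurrent_def by blast+
  then show "a * w (n + 2) + b * w' (n + 2) = B * (a * w (n + 1) + b * w' (n + 1)) - C * (a * w n + b * w' n)"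
    by (simp only:) (simp add: algebra_simps)
qed

text \<open>The coefficients come from continuing w back to index 0, where C w_0 would be B w_1 -
  w_2 while V and U take the values 2 and 0. The factor 2 C clears the denominators.\<close>

lemma recurrent_lucas_decomposition:
  assumes "recurrent B C w" "n \<ge> 1"
  shows "2 * C * w n = (B * w 1 - w 2) * lucas_V B C n + (2 * C * w 1 - (B * w 1 - w 2) * B) * lucas_U B C n"
proof -
  have "recurrent B C (\<lambda>n. (2 * C) * w n + 0 * w n)"
    by (intro recurrent_linear assms)
  then have "recurrent B C (\<lambda>n. 2 * C * w n)" by simp
  then show ?thesis
    by (rule recurrent_eqI[OF _ recurrent_linear[OF recurrent_lucas]])
      (use assms(2) in \<open>simp_all add: numeral_2_eq_2 power2_eq_square algebra_simps\<close>)
qed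

text \<open>Binet's formulas with denominators cleared; B + s and B - s are twice the roots.\<close>

lemma lucas_closed_form:
  fixes s :: real
  assumes "s\<^sup>2 = of_int (B\<^sup>2 - 4 * C)"
  shows "2 ^ n * real_of_int (lucas_V B C n) = (B + s) ^ n + (B - s) ^ n"
    and "2 ^ n * s * real_of_int (lucas_U B C n) = (B + s) ^ n - (B - s) ^ n"
proof -
  have root: "x ^ Suc (Suc n) = 2 * B * x ^ Suc n - 4 * C * x ^ n" if "x = B + s \<or> x = B - s" for x :: real and n
  proof -
    have "(x - B)\<^sup>2 = B\<^sup>2 - 4 * C" using that assms by auto
    then have "x\<^sup>2 = 2 * B * x - 4 * C" by (simp add: power2_diff algebra_simps)
    then have "x ^ n * x\<^sup>2 = x ^ n * (2 * B * x - 4 * C)" by simp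
    then show ?thesis by (simp add: power2_eq_square algebra_simps)
  qed
  show "2 ^ n * real_of_int (lucas_V B C n) = (B + s) ^ n + (B - s) ^ n"
  proof (induction n rule: induct_nat_012)
    case (ge2 n)
    have "2 ^ Suc (Suc n) * real_of_int (lucas_V B C (Suc (Suc n))) =
      2 * real_of_int B * (2 ^ Suc n * real_of_int (lucas_V B C (Suc n))) - 4 * real_of_int C * (2 ^ n * real_of_int (lucas_V B C n))"
      by (simp add: algebra_simps)
    then show ?case
      by (simp only: ge2 root[of "B + s", OF disjI1[OF refl]] root[of "B - s", OF disjI2[OF refl]])
        (simp add: algebra_simps)
  qed auto
  show "2 ^ n * s * real_of_int (lucas_U B C n) = (B + s) ^ n - (B - s) ^ n"
  proof (induction n rule: induct_nat_012)
    case (ge2 n)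
    have "2 ^ Suc (Suc n) * s * real_of_int (lucas_U B C (Suc (Suc n))) =
      2 * real_of_int B * (2 ^ Suc n * s * real_of_int (lucas_U B C (Suc n))) - 4 * real_of_int C * (2 ^ n * s * real_of_int (lucas_U B C n))"
      by (simp add: algebra_simps)
    then show ?case
      by (simp only: ge2 root[of "B + s", OF disjI1[OF refl]] root[of "B - s", OF disjI2[OF refl]])
        (simp add: algebra_simps)
  qed auto
qed

text \<open>Odd powers are strictly increasing on the reals, and B - s < B + s in Binet's
  formula.\<close>

lemma lucas_U_odd_pos:
  assumes "B\<^sup>2 - 4 * C > 0" "odd n"
  shows "lucas_U B C n > 0"
proof -
  define s where "s = sqrt (of_int (B\<^sup>2 - 4 * C))"
  have "real_of_int (B\<^sup>2 - 4 * C) > 0" using assms(1) by (simp only: of_int_0_less_iff)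
  then have s: "s\<^sup>2 = of_int (B\<^sup>2 - 4 * C)" "s > 0"
    unfolding s_def by (intro real_sqrt_pow2 real_sqrt_gt_zero; simp)+
  have "(B - s) ^ n \<le> (B + s) ^ n"
    using s(2) by (intro power_mono_odd assms) auto
  moreover have "(B - s) ^ n \<noteq> (B + s) ^ n"
  proof
    assume "(B - s) ^ n = (B + s) ^ n"
    then have "root n ((B - s) ^ n) = root n ((B + s) ^ n)" by (rule arg_cong)
    then show False using s(2) by (simp add: odd_real_root_power_cancel assms(2))
  qed
  ultimately have "(B - s) ^ n < (B + s) ^ n" by simp
  then have "2 ^ n * s * lucas_U B C n > 0" using lucas_closed_form(2)[OF s(1), of n] by simp
  moreover have "2 ^ n * s > 0" using s(2) by simp
  ultimately have "real_of_int (lucas_U B C n) > 0" by (rule zero_less_mult_pos)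
  then show ?thesis by simp
qed

lemma sum_choose_prime_cong:
  fixes g :: "nat \<Rightarrow> int"
  assumes "prime p"
  shows "[(\<Sum>j\<le>p. of_nat (p choose j) * g j) = g 0 + g p] (mod int p)"
proof -
  have p: "p > 0" using assms prime_gt_0_nat by blast
  have "{..p} = insert 0 (insert p {0<..<p})" using p by auto
  then have "(\<Sum>j\<le>p. of_nat (p choose j) * g j) - (g 0 + g p) = (\<Sum>j\<in>{0<..<p}. int (p choose j) * g j)"
    using p by simp
  moreover have "int p dvd (\<Sum>j\<in>{0<..<p}. int (p choose j) * g j)"
    using assms by (intro dvd_sum dvd_mult2) (auto intro!: dvd_choose_prime)
  ultimately show ?thesis by (simp add: cong_iff_dvd_diff)
qed

text \<open>In the binomial expansion of Binet's formulas only the end terms survive modulo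
  \<open>p\<close>: B^p, congruent to B, for V, and s^p / s, a power of the discriminant, for U. The
  factor 2^p is congruent to 2 and cancels.\<close>

lemma lucas_prime_cong:
  assumes "B\<^sup>2 - 4 * C > 0" "prime p" "p > 2"
  shows "[lucas_V B C p = B] (mod p)"
    and "[lucas_U B C p = (B\<^sup>2 - 4 * C) ^ (p div 2)] (mod p)"
proof -
  define D where "D = B\<^sup>2 - 4 * C"
  define s where "s = sqrt (of_int D)"
  have "real_of_int D > 0" using assms(1) by (simp only: of_int_0_less_iff D_def)
  then have s: "s\<^sup>2 = of_int D" "s > 0"
    unfolding s_def by (intro real_sqrt_pow2 real_sqrt_gt_zero; simp)+
  have cf: "2 ^ n * real_of_int (lucas_V B C n) = (B + s) ^ n + (B - s) ^ n"
    "2 ^ n * s * lucas_U B C n = (B + s) ^ n - (B - s) ^ n" for n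
    using lucas_closed_form[of s B C] s(1) by (auto simp: D_def)
  have "odd p" using assms prime_odd_nat by blast
  have two: "[2 * 2 ^ (p - 1) * x = 2 * x] (mod p)" for x :: int
  proof -
    have "\<not> int p dvd 2" using assms(3) zdvd_imp_le[of "int p" 2] by auto
    then have "[2 * 2 ^ (p - 1) * x = 2 * 1 * x] (mod p)"
      by (intro cong_mult cong_refl fermat_theorem_int assms)
    then show ?thesis by simp
  qed
  have canc: "[x = y] (mod p)" if "[2 * x = 2 * y] (mod p)" for x y :: int
  proof -
    have "coprime 2 (int p)" using \<open>odd p\<close> by simp
    then show ?thesis using that by (simp add: cong_mult_lcancel)
  qed
  have p2: "2 ^ p = (2 * 2 ^ (p - 1) :: 'a::comm_semiring_1)" using assms(3) by (cases p) auto
  have exp: "(B + s) ^ p = (\<Sum>j\<le>p. of_nat (p choose j) * s ^ j * B ^ (p - j))"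
    "(B - s) ^ p = (\<Sum>j\<le>p. of_nat (p choose j) * (- s) ^ j * B ^ (p - j))"
    using binomial_ring[of s "real_of_int B" p] binomial_ring[of "- s" "real_of_int B" p]
    by (simp_all add: add.commute)
  \<comment> \<open>Cofactors of the binomial coefficients in the sum and the difference of the
    \<open>p\<close>-th powers of B + s and B - s, the latter divided by s. Terms of the wrong
    parity cancel.\<close>
  define gV where "gV = (\<lambda>j. if even j then 2 * B ^ (p - j) * D ^ (j div 2) else 0)"
  define gU where "gU = (\<lambda>j. if odd j then 2 * B ^ (p - j) * D ^ (j div 2) else 0)"
  have sj: "s ^ j + (- s) ^ j = (if even j then 2 * D ^ (j div 2) else 0)"
    "s ^ j - (- s) ^ j = s * (if odd j then 2 * D ^ (j div 2) else 0)" for j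
    by (auto elim!: evenE oddE simp: power_mult s(1))
  have "real_of_int (2 ^ p * lucas_V B C p) = real_of_int (\<Sum>j\<le>p. of_nat (p choose j) * gV j)"
  proof -
    have "real_of_int (2 ^ p * lucas_V B C p) = (B + s) ^ p + (B - s) ^ p" using cf(1)[of p] by simp
    also have "\<dots> = (\<Sum>j\<le>p. of_nat (p choose j) * (B ^ (p - j) * (s ^ j + (- s) ^ j)))"
      unfolding exp sum.distrib[symmetric] by (intro sum.cong) (auto simp: algebra_simps)
    also have "\<dots> = real_of_int (\<Sum>j\<le>p. of_nat (p choose j) * gV j)"
      unfolding sj of_int_sum by (intro sum.cong) (auto simp: gV_def)
    finally show ?thesis .
  qed
  then have "2 ^ p * lucas_V B C p = (\<Sum>j\<le>p. of_nat (p choose j) * gV j)" by linarith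
  then have "[2 * 2 ^ (p - 1) * lucas_V B C p = gV 0 + gV p] (mod p)"
    using sum_choose_prime_cong[OF assms(2), of gV] by (simp add: p2)
  then have "[2 * lucas_V B C p = gV 0 + gV p] (mod p)" using two cong_sym cong_trans by blast
  also have "gV 0 + gV p = 2 * B ^ p" using \<open>odd p\<close> by (simp add: gV_def)
  finally have "[lucas_V B C p = B ^ p] (mod p)" by (rule canc)
  moreover have "[B ^ p = B] (mod p)"
  proof (cases "int p dvd B")
    case True
    moreover have "int p dvd B ^ p" using True assms(3) by (simp add: dvd_power_le[of _ _ 1 p, simplified])
    ultimately show ?thesis by (simp add: cong_def)
  next
    case False
    have "[B * B ^ (p - 1) = B * 1] (mod p)"
      by (intro cong_mult cong_refl fermat_theorem_int assms False)
    then show ?thesis using assms(3) by (cases p) auto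
  qed
  ultimately show "[lucas_V B C p = B] (mod p)" by (rule cong_trans)
  have "s * real_of_int (2 ^ p * lucas_U B C p) = s * real_of_int (\<Sum>j\<le>p. of_nat (p choose j) * gU j)"
  proof -
    have "s * real_of_int (2 ^ p * lucas_U B C p) = (B + s) ^ p - (B - s) ^ p" using cf(2)[of p] by (simp add: mult_ac)
    also have "\<dots> = (\<Sum>j\<le>p. of_nat (p choose j) * (B ^ (p - j) * (s ^ j - (- s) ^ j)))"
      unfolding exp sum_subtractf[symmetric] by (intro sum.cong) (auto simp: algebra_simps)
    also have "\<dots> = s * real_of_int (\<Sum>j\<le>p. of_nat (p choose j) * gU j)"
      unfolding sj of_int_sum sum_distrib_left by (intro sum.cong) (auto simp: gU_def)
    finally show ?thesis .
  qed
  then have "real_of_int (2 ^ p * lucas_U B C p) = real_of_int (\<Sum>j\<le>p. of_nat (p choose j) * gU j)"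
    using s(2) by simp
  then have "2 ^ p * lucas_U B C p = (\<Sum>j\<le>p. of_nat (p choose j) * gU j)" by linarith
  then have "[2 * 2 ^ (p - 1) * lucas_U B C p = gU 0 + gU p] (mod p)"
    using sum_choose_prime_cong[OF assms(2), of gU] by (simp add: p2)
  then have "[2 * lucas_U B C p = gU 0 + gU p] (mod p)" using two cong_sym cong_trans by blast
  also have "gU 0 + gU p = 2 * D ^ (p div 2)" using \<open>odd p\<close> by (simp add: gU_def)
  finally show "[lucas_U B C p = (B\<^sup>2 - 4 * C) ^ (p div 2)] (mod p)" unfolding D_def by (rule canc)
qed

section \<open>Which solutions survive the prime congruences\<close>

lemma realisable_abs_cong:
  assumes "realisable (\<lambda>n. nat \<bar>w n\<bar>)" "prime p" "m \<ge> 1"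
  shows "[\<bar>w (m * p)\<bar> = \<bar>w m\<bar>] (mod int p)"
proof -
  have "[int (nat \<bar>w (m * p)\<bar>) = int (nat \<bar>w m\<bar>)] (mod int p)"
    using realisable_cong_prime[OF assms] by (simp only: cong_int_iff)
  then show ?thesis by simp
qed

text \<open>Squaring removes the absolute values without a case distinction on signs.\<close>

lemma realisable_square_cong:
  assumes "realisable (\<lambda>n. nat \<bar>w n\<bar>)" "prime p"
  shows "[(w p)\<^sup>2 = (w 1)\<^sup>2] (mod int p)"
proof -
  have "[\<bar>w p\<bar>\<^sup>2 = \<bar>w 1\<bar>\<^sup>2] (mod int p)"
    using realisable_abs_cong[OF assms, of 1] by (intro cong_pow) simp
  then show ?thesis by simp
qed

text \<open>Turns congruences modulo arbitrarily large primes into equalities of integers.\<close>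

lemma dvd_unbounded_imp_0:
  fixes x :: int and P :: "nat \<Rightarrow> bool"
  assumes "\<And>M. \<exists>p>M. P p" "\<And>p. P p \<Longrightarrow> int p dvd x"
  shows "x = 0"
proof (rule ccontr)
  assume "x \<noteq> 0"
  obtain p where "p > nat \<bar>x\<bar>" "P p" using assms(1) by blast
  then show False using assms(2)[of p] \<open>x \<noteq> 0\<close> dvd_imp_le_int[of x "int p"] by simp
qed

text \<open>With g and h the coefficients of V and U, at an inert \<open>p\<close> the number 2 C
  w_p is congruent to g B - h, while 2 C w_1 = g B + h. Equality of the squares modulo infinitely
  many \<open>p\<close> forces g B h = 0.\<close>

lemma nonsquare_realisable_proportional:
  assumes w: "recurrent B C w" and real: "realisable (\<lambda>n. nat \<bar>w n\<bar>)"
    and B: "B \<noteq> 0" and D: "B\<^sup>2 - 4 * C > 0" "\<not> is_square (B\<^sup>2 - 4 * C)" and n: "n \<ge> 1"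
  shows "2 * C * w n = (B * w 1 - w 2) * lucas_V B C n"
proof -
  define g where "g = B * w 1 - w 2"
  define h where "h = 2 * C * w 1 - g * B"
  have dec: "2 * C * w n = g * lucas_V B C n + h * lucas_U B C n" if "n \<ge> 1" for n
    using recurrent_lucas_decomposition[OF w that] by (simp add: g_def h_def)
  have "C \<noteq> 0" using D(2) by auto
  define inert where "inert = (\<lambda>p. prime p \<and> p > 2 \<and> Legendre (B\<^sup>2 - 4 * C) (int p) = -1)"
  have ex: "\<exists>p>M. inert p" for M
  proof -
    define d where "d = nat (B\<^sup>2 - 4 * C)"
    have d: "int d = B\<^sup>2 - 4 * C" using D by (simp add: d_def)
    have "\<not> is_square d"
    proof
      assume "is_square d"
      then obtain k where "d = k\<^sup>2" by (rule is_nth_powerE)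
      then have "B\<^sup>2 - 4 * C = (int k)\<^sup>2" using d by simp
      then show False using D(2) by (metis is_nth_power_nth_power)
    qed
    from infinitely_many_inert_primes[OF this, of M] show ?thesis
      unfolding inert_def using d by metis
  qed
  have UV: "[lucas_V B C p = B] (mod int p)" "[lucas_U B C p = -1] (mod int p)" if "inert p" for p
  proof -
    have p: "prime p" "p > 2" "Legendre (B\<^sup>2 - 4 * C) (int p) = -1" using that by (auto simp: inert_def)
    show "[lucas_V B C p = B] (mod int p)" by (rule lucas_prime_cong(1)[OF D(1) p(1,2)])
    have "odd p" using p prime_odd_nat by blast
    then have "(p - 1) div 2 = p div 2" by (auto elim: oddE)
    then have "[- 1 = (B\<^sup>2 - 4 * C) ^ (p div 2)] (mod int p)"
      using euler_criterion[OF p(1,2), of "B\<^sup>2 - 4 * C"] p(3) by simp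
    with lucas_prime_cong(2)[OF D(1) p(1,2)] show "[lucas_U B C p = -1] (mod int p)"
      using cong_sym cong_trans by blast
  qed
  have "g * B * h = 0"
  proof -
    have "4 * (g * B * h) = 0"
    proof (rule dvd_unbounded_imp_0[of inert])
      fix p assume p: "inert p"
      then have "prime p" by (simp add: inert_def)
      then have "p \<ge> 1" using prime_gt_0_nat[of p] by simp
      have "[2 * C * w p = g * B + h * (-1)] (mod int p)"
        unfolding dec[OF \<open>p \<ge> 1\<close>] using UV[OF p] by (intro cong_add cong_mult cong_refl)
      then have "[(2 * C * w p)\<^sup>2 = (g * B + h * (-1))\<^sup>2] (mod int p)" by (rule cong_pow)
      moreover have "[(2 * C * w p)\<^sup>2 = (2 * C * w 1)\<^sup>2] (mod int p)"
        unfolding power_mult_distrib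
        by (intro cong_mult cong_refl realisable_square_cong real \<open>prime p\<close>)
      moreover have "2 * C * w 1 = g * B + h" by (simp add: h_def)
      ultimately have "[(g * B + h)\<^sup>2 = (g * B + h * (-1))\<^sup>2] (mod int p)"
        using cong_sym cong_trans by metis
      moreover have "(g * B + h)\<^sup>2 - (g * B + h * (-1))\<^sup>2 = 4 * (g * B * h)"
        by (simp add: power2_eq_square algebra_simps)
      ultimately show "int p dvd 4 * (g * B * h)" by (simp add: cong_iff_dvd_diff)
    qed (rule ex)
    then show ?thesis by simp
  qed
  then consider "h = 0" | "g = 0" using B by auto
  then show ?thesis
  proof cases
    case 1
    then show ?thesis using dec[OF n] by (simp add: g_def)
  next
    case 2
    have wU: "w n = w 1 * lucas_U B C n" if "n \<ge> 1" for n
      using dec[OF that] 2 \<open>C \<noteq> 0\<close> by (simp add: h_def)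
    \<comment> \<open>The term U_p is positive but congruent to -1, so |w_p| is congruent to both
      -|w_1| and |w_1|.\<close>
    have "2 * \<bar>w 1\<bar> = 0"
    proof (rule dvd_unbounded_imp_0[of inert])
      fix p assume p: "inert p"
      then have pp: "prime p" "p > 2" by (simp_all add: inert_def)
      then have "p \<ge> 1" "odd p" using prime_odd_nat[of p] by auto
      have "\<bar>w p\<bar> = \<bar>w 1\<bar> * lucas_U B C p"
        using wU[OF \<open>p \<ge> 1\<close>] lucas_U_odd_pos[OF D(1) \<open>odd p\<close>] by (simp add: abs_mult)
      moreover have "[\<bar>w 1\<bar> * lucas_U B C p = \<bar>w 1\<bar> * (-1)] (mod int p)"
        by (intro cong_mult cong_refl UV p)
      moreover have "[\<bar>w p\<bar> = \<bar>w 1\<bar>] (mod int p)"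
        using realisable_abs_cong[OF real pp(1), of 1] by simp
      ultimately have "[\<bar>w 1\<bar> = \<bar>w 1\<bar> * (-1)] (mod int p)" using cong_sym cong_trans by metis
      then show "int p dvd 2 * \<bar>w 1\<bar>" by (simp add: cong_iff_dvd_diff)
    qed (rule ex)
    then have "w 1 = 0" by simp
    then show ?thesis using wU[OF n] wU[of 2] by simp
  qed
qed

text \<open>The defect d measures the deviation from a geometric sequence. Since p - 1 is congruent
  to -1, \<alpha> w_p is congruent to \<alpha> w_1 - d, and comparing squares leaves d = 0 or d = 2
  \<alpha> w_1.\<close>

lemma double_root_realisable_geometric:
  assumes w: "recurrent (2 * \<alpha>) (\<alpha>\<^sup>2) w" and real: "realisable (\<lambda>n. nat \<bar>w n\<bar>)"
    and \<alpha>: "\<alpha> \<noteq> 0"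
  shows "w 2 = \<alpha> * w 1"
proof -
  define d where "d = w 2 - \<alpha> * w 1"
  define P where "P = (\<lambda>p. prime p \<and> \<not> int p dvd \<alpha>)"
  have ex: "\<exists>p>M. P p" for M
  proof -
    obtain p where p: "prime p" "p > max M (nat \<bar>\<alpha>\<bar>)" using bigger_prime by blast
    then have "\<not> int p dvd \<alpha>" using \<alpha> dvd_imp_le_int[of \<alpha> "int p"] by auto
    then show ?thesis using p by (auto simp: P_def)
  qed
  have formula: "\<alpha> * w (Suc n) = \<alpha> ^ n * (\<alpha> * w 1 + int n * d)" for n
  proof (induction n rule: induct_nat_012)
    case (ge2 n)
    have "\<alpha> * w (Suc (Suc (Suc n))) = 2 * \<alpha> * (\<alpha> * w (Suc (Suc n))) - \<alpha>\<^sup>2 * (\<alpha> * w (Suc n))"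
      by (simp add: recurrent_step[OF w] algebra_simps)
    then show ?case unfolding ge2 by (simp add: power2_eq_square algebra_simps)
  qed (simp_all add: d_def numeral_2_eq_2 algebra_simps)
  have fermat: "[\<alpha> ^ (p - 1) = 1] (mod int p)" if "P p" for p
    using that by (intro fermat_theorem_int) (auto simp: P_def)
  have pred: "[int (p - 1) = -1] (mod int p)" if "P p" for p
    using that prime_gt_0_nat[of p] by (simp add: P_def of_nat_diff cong_iff_dvd_diff)
  have wp: "[\<alpha> * w p = \<alpha> * w 1 - d] (mod int p)" if "P p" for p
  proof -
    have "p > 0" using that prime_gt_0_nat by (simp add: P_def)
    then have "\<alpha> * w p = \<alpha> ^ (p - 1) * (\<alpha> * w 1 + int (p - 1) * d)"
      using formula[of "p - 1"] by simp
    moreover have "[\<alpha> ^ (p - 1) * (\<alpha> * w 1 + int (p - 1) * d) = 1 * (\<alpha> * w 1 + (-1) * d)] (mod int p)"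
      using that by (intro cong_mult cong_add cong_refl fermat pred)
    ultimately show ?thesis by simp
  qed
  have "d * (d - 2 * \<alpha> * w 1) = 0"
  proof (rule dvd_unbounded_imp_0[of P])
    fix p assume p: "P p"
    have "[(\<alpha> * w p)\<^sup>2 = (\<alpha> * w 1 - d)\<^sup>2] (mod int p)" using wp[OF p] by (rule cong_pow)
    moreover have "[(\<alpha> * w p)\<^sup>2 = (\<alpha> * w 1)\<^sup>2] (mod int p)"
      unfolding power_mult_distrib using p
      by (intro cong_mult cong_refl realisable_square_cong real) (simp add: P_def)
    ultimately have "[(\<alpha> * w 1 - d)\<^sup>2 = (\<alpha> * w 1)\<^sup>2] (mod int p)" using cong_sym cong_trans by blast
    then show "int p dvd d * (d - 2 * \<alpha> * w 1)"
      by (simp add: cong_iff_dvd_diff power2_eq_square algebra_simps)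
  qed (rule ex)
  then consider "d = 0" | "d = 2 * \<alpha> * w 1" by auto
  then show ?thesis
  proof cases
    case 2
    have wn: "w (Suc n) = \<alpha> ^ n * (w 1 * (2 * int n + 1))" for n
    proof -
      have "\<alpha> * w (Suc n) = \<alpha> * (\<alpha> ^ n * (w 1 * (2 * int n + 1)))"
        unfolding formula 2 by (simp add: algebra_simps)
      then show ?thesis using \<alpha> by simp
    qed
    \<comment> \<open>At n = p - 1 the positive factor 2 n + 1 is congruent to -1, so |w_p| is
      congruent to -|w_1| as well as to |w_1|.\<close>
    have "2 * \<bar>w 1\<bar> = 0"
    proof (rule dvd_unbounded_imp_0[of P])
      fix p assume p: "P p"
      then have "p > 0" using prime_gt_0_nat by (simp add: P_def)
      then have "\<bar>w p\<bar> = \<bar>\<alpha> ^ (p - 1)\<bar> * (\<bar>w 1\<bar> * (2 * int (p - 1) + 1))"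
        using wn[of "p - 1"] by (simp add: abs_mult)
      also have "\<bar>\<alpha> ^ (p - 1)\<bar> = \<bar>\<alpha>\<bar> ^ (p - 1)" by (rule power_abs)
      finally have "\<bar>w p\<bar> = \<bar>\<alpha>\<bar> ^ (p - 1) * (\<bar>w 1\<bar> * (2 * int (p - 1) + 1))" .
      moreover have "[\<bar>\<alpha>\<bar> ^ (p - 1) * (\<bar>w 1\<bar> * (2 * int (p - 1) + 1)) = 1 * (\<bar>w 1\<bar> * (2 * (-1) + 1))] (mod int p)"
        using p by (intro cong_mult cong_add cong_refl pred fermat_theorem_int) (auto simp: P_def)
      moreover have "[\<bar>w p\<bar> = \<bar>w 1\<bar>] (mod int p)"
        using realisable_abs_cong[OF real, of p 1] p by (simp add: P_def)
      ultimately have "[\<bar>w 1\<bar> = 1 * (\<bar>w 1\<bar> * (2 * (-1) + 1))] (mod int p)"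
        using cong_sym cong_trans by metis
      then show "int p dvd 2 * \<bar>w 1\<bar>" by (simp add: cong_iff_dvd_diff)
    qed (rule ex)
    then show ?thesis using 2 by (simp add: d_def)
  qed (simp add: d_def)
qed

text \<open>At a split prime \<open>p\<close>, w_i and w_(i p) are congruent, and by realisability
  so are their absolute values. At an index i where the two have opposite signs, \<open>p\<close>
  then divides 2 w_i, although w_i is congruent to a fixed w_m not divisible by
  \<open>p\<close>.\<close>

lemma negative_discriminant_realisable_zero:
  fixes \<alpha> :: complex
  assumes w: "recurrent B C w" and real: "realisable (\<lambda>n. nat \<bar>w n\<bar>)"
    and disc: "B\<^sup>2 - 4 * C < 0"
    and B: "of_int B = \<alpha> + cnj \<alpha>" and C: "of_int C = \<alpha> * cnj \<alpha>"
    and ratio: "\<And>k. k \<ge> 1 \<Longrightarrow> (\<alpha> / cnj \<alpha>) ^ k \<noteq> 1"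
    and n: "n \<ge> 1"
  shows "w n = 0"
proof (rule ccontr)
  assume "w n \<noteq> 0"
  have "C > 0" using disc zero_le_power2[of B] by linarith
  then have \<alpha>0: "\<alpha> \<noteq> 0" using C by auto
  have \<delta>: "\<alpha> - cnj \<alpha> \<noteq> 0" using ratio[of 1] \<alpha>0 by auto
  \<comment> \<open>The coefficient of \<alpha>^n in w_n; that of the conjugate power is
    \<open>cnj a\<close> because w is real.\<close>
  define a where "a = (of_int (w 2) - cnj \<alpha> * of_int (w 1)) / (\<alpha> * (\<alpha> - cnj \<alpha>))"
  have closed: "(\<alpha> - cnj \<alpha>) * of_int (w (Suc m)) =
    (of_int (w 2) - cnj \<alpha> * of_int (w 1)) * \<alpha> ^ m + (\<alpha> * of_int (w 1) - of_int (w 2)) * cnj \<alpha> ^ m" for m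
  proof (induction m rule: induct_nat_012)
    case (ge2 m)
    have "(\<alpha> - cnj \<alpha>) * of_int (w (Suc (Suc (Suc m)))) =
      (\<alpha> + cnj \<alpha>) * ((\<alpha> - cnj \<alpha>) * of_int (w (Suc (Suc m)))) - (\<alpha> * cnj \<alpha>) * ((\<alpha> - cnj \<alpha>) * of_int (w (Suc m)))"
      by (simp only: recurrent_step[OF w] of_int_diff of_int_mult B C) (simp only: algebra_simps)
    then show ?case by (simp only: ge2) (simp add: algebra_simps)
  qed (simp_all add: numeral_2_eq_2 algebra_simps)
  have wa: "of_real (real_of_int (w m)) = a * \<alpha> ^ m + cnj a * cnj \<alpha> ^ m" if m: "m \<ge> 1" for m
  proof -
    obtain l where l: "m = Suc l" using m by (cases m) auto
    have "(\<alpha> - cnj \<alpha>) * (a * \<alpha> ^ Suc l) = (of_int (w 2) - cnj \<alpha> * of_int (w 1)) * \<alpha> ^ l"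
      using \<alpha>0 \<delta> by (simp add: a_def)
    moreover have "(\<alpha> - cnj \<alpha>) * (cnj a * cnj \<alpha> ^ Suc l) = (\<alpha> * of_int (w 1) - of_int (w 2)) * cnj \<alpha> ^ l"
    proof -
      have "cnj \<alpha> - \<alpha> \<noteq> 0" using \<delta> by auto
      then have "(cnj \<alpha> - \<alpha>) * (cnj a * cnj \<alpha> ^ Suc l) = (of_int (w 2) - \<alpha> * of_int (w 1)) * cnj \<alpha> ^ l"
        using \<alpha>0 by (simp add: a_def)
      then have "- ((cnj \<alpha> - \<alpha>) * (cnj a * cnj \<alpha> ^ Suc l)) = - ((of_int (w 2) - \<alpha> * of_int (w 1)) * cnj \<alpha> ^ l)"
        by (rule arg_cong)
      then show ?thesis by (simp only: minus_mult_left minus_diff_eq)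
    qed
    ultimately have "(\<alpha> - cnj \<alpha>) * of_int (w m) = (\<alpha> - cnj \<alpha>) * (a * \<alpha> ^ m + cnj a * cnj \<alpha> ^ m)"
      unfolding l distrib_left closed by (simp only:)
    then show ?thesis using \<delta> by simp
  qed
  then have a0: "a \<noteq> 0" using n \<open>w n \<noteq> 0\<close> by fastforce
  have "w 1 \<noteq> 0 \<or> w 2 \<noteq> 0"
  proof (rule ccontr)
    assume "\<not> ?thesis"
    then have "a = 0" by (simp add: a_def)
    with a0 show False by simp
  qed
  then obtain m where m: "m \<ge> 1" "w m \<noteq> 0" by (metis one_le_numeral order_refl)
  \<comment> \<open>Large enough that \<open>p\<close> divides none of 2, w_m, C and the
    discriminant.\<close>
  define M where "M = nat (\<bar>w m\<bar> + \<bar>B\<^sup>2 - 4 * C\<bar> + C + 2)"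
  obtain p s where p: "prime p" "p > M" and s: "[s * (B - s) = C] (mod int p)"
    using ex_split_prime[OF \<open>C > 0\<close>] by blast
  have ndvd: "\<not> int p dvd x" if "x \<noteq> 0" "\<bar>x\<bar> \<le> int M" for x
    using that p(2) dvd_imp_le_int[of x "int p"] by auto
  have pC: "\<not> int p dvd C" and pD: "\<not> int p dvd B\<^sup>2 - 4 * C" and pm: "\<not> int p dvd 2 * w m"
  proof -
    show "\<not> int p dvd C" "\<not> int p dvd B\<^sup>2 - 4 * C"
      using \<open>C > 0\<close> disc by (intro ndvd; simp add: M_def)+
    have "\<not> int p dvd 2" "\<not> int p dvd w m" using m \<open>C > 0\<close> by (intro ndvd; simp add: M_def)+
    then show "\<not> int p dvd 2 * w m" using p(1) by (simp add: prime_dvd_mult_iff)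
  qed
  have p1: "p - 1 \<ge> 1" "Suc (p - 1) = p" using prime_ge_2_nat[OF p(1)] by auto
  \<comment> \<open>Taking the step q = p - 1 makes the multiplier \<open>Suc q\<close> equal to
    \<open>p\<close> and keeps the index in the class of m modulo p - 1.\<close>
  obtain j where j: "real_of_int (w (m + (p - 1) * j)) * real_of_int (w ((m + (p - 1) * j) * Suc (p - 1))) < 0"
    by (rule conjugate_sum_changes_sign[OF wa a0 \<alpha>0 ratio p1(1) m(1)])
  define i where "i = m + (p - 1) * j"
  have i1: "i \<ge> 1" using m by (simp add: i_def)
  have per: "[w (i + k * (p - 1)) = w m] (mod int p)" for k
  proof -
    have "i + k * (p - 1) = m + (j + k) * (p - 1)" by (simp add: i_def distrib_right mult.commute)
    then show ?thesis
      using recurrent_split_prime_periodic[OF w p(1) s pC pD m(1), of "j + k"] by simp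
  qed
  have wi: "[w i = w m] (mod int p)" using per[of 0] by simp
  \<comment> \<open>So i p and i lie in the same class modulo the period p - 1.\<close>
  have "i * p = i + i * (p - 1)" using p1 by (metis mult_Suc_right)
  then have wip: "[w (i * p) = w m] (mod int p)" using per[of i] by simp
  have "real_of_int (w i * w (i * p)) < 0" using j unfolding p1(2) by (simp add: i_def)
  then have "w i * w (i * p) < 0" by linarith
  then have sgn: "\<bar>w (i * p)\<bar> + \<bar>w i\<bar> = \<bar>w (i * p) - w i\<bar>" by (auto simp: mult_less_0_iff)
  have "[w (i * p) = w i] (mod int p)" using wip cong_sym[OF wi] by (rule cong_trans)
  then have "int p dvd \<bar>w (i * p)\<bar> + \<bar>w i\<bar>" unfolding sgn by (simp add: cong_iff_dvd_diff)
  moreover have "int p dvd \<bar>w (i * p)\<bar> - \<bar>w i\<bar>"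
    using realisable_abs_cong[OF real p(1) i1] by (simp add: cong_iff_dvd_diff)
  ultimately have "int p dvd (\<bar>w (i * p)\<bar> + \<bar>w i\<bar>) - (\<bar>w (i * p)\<bar> - \<bar>w i\<bar>)" by (rule dvd_diff)
  then have "int p dvd \<bar>2 * w i\<bar>" by (simp add: abs_mult)
  then have "int p dvd 2 * w i" by simp
  moreover have "[2 * w i = 2 * w m] (mod int p)" by (intro cong_mult cong_refl wi)
  ultimately show False using pm cong_dvd_iff by blast
qed

section \<open>Dimension of the realisable subspace\<close>

lemma realisable_cong:
  assumes "\<And>n. n \<ge> 1 \<Longrightarrow> v n = v' n"
  shows "realisable v \<longleftrightarrow> realisable v'"
  using assms by (simp add: realisable_def realises_def)

lemma realisable_solutionsE:
  assumes "u \<in> realisable_solutions B C"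
  obtains w where "u = (\<lambda>n. of_int (w n))" "w 0 = 0" "recurrent B C w" "realisable (\<lambda>n. nat \<bar>w n\<bar>)"
proof -
  obtain w where w: "u = (\<lambda>n. of_int (w n))" "realisable (\<lambda>n. nat \<bar>w n\<bar>)" "u \<in> rec_solutions B C"
    using assms by (auto simp: realisable_solutions_def)
  have "w 0 = 0" using w(1,3) by (simp add: rec_solutions_def)
  moreover have "recurrent B C w"
    unfolding recurrent_def
  proof (intro allI impI)
    fix n :: nat assume "n \<ge> 1"
    then have "u (n + 2) = of_int B * u (n + 1) - of_int C * u n"
      using w(3) unfolding rec_solutions_def by blast
    then have "complex_of_int (w (n + 2)) = of_int (B * w (n + 1) - C * w n)"
      unfolding w(1) by (simp only: of_int_mult of_int_diff)
    then show "w (n + 2) = B * w (n + 1) - C * w n" by (simp only: of_int_eq_iff)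
  qed
  ultimately show thesis using that w by blast
qed

lemma realisable_solutionsI:
  assumes "recurrent B C w" "realisable (\<lambda>n. nat \<bar>w n\<bar>)"
  shows "(\<lambda>n. if n = 0 then 0 else of_int (w n)) \<in> realisable_solutions B C"
proof -
  define w' where "w' = (\<lambda>n. if n = 0 then 0 else w n)"
  have "(\<lambda>n. if n = 0 then 0 else complex_of_int (w n)) = (\<lambda>n. of_int (w' n))"
    by (auto simp: w'_def)
  moreover have "realisable (\<lambda>n. nat \<bar>w' n\<bar>)"
    using assms(2) by (subst realisable_cong[where v' = "\<lambda>n. nat \<bar>w n\<bar>"]) (auto simp: w'_def)
  moreover have "(\<lambda>n. complex_of_int (w' n)) \<in> rec_solutions B C"
    unfolding rec_solutions_def
  proof (intro CollectI conjI allI impI)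
    fix n :: nat assume "n \<ge> 1"
    then have "w' (n + 2) = B * w' (n + 1) - C * w' n"
      using assms(1) unfolding recurrent_def w'_def by simp
    then show "complex_of_int (w' (n + 2)) = of_int B * of_int (w' (n + 1)) - of_int C * of_int (w' n)"
      by (simp only: of_int_mult of_int_diff)
  qed (simp add: w'_def)
  ultimately show ?thesis unfolding realisable_solutions_def by auto
qed

lemma rec_solutions_eqI:
  assumes "u \<in> rec_solutions B C" "u' \<in> rec_solutions B C" "u 1 = u' 1" "u 2 = u' 2"
  shows "u = u'"
proof
  have step: "x (Suc (Suc (Suc n))) = of_int B * x (Suc (Suc n)) - of_int C * x (Suc n)"
    if "x \<in> rec_solutions B C" for x n
    using that unfolding rec_solutions_def by (metis (mono_tags, lifting) CollectD Suc_eq_plus1 add_2_eq_Suc' le_add2)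
  have "u (Suc n) = u' (Suc n)" for n
    using assms(3,4)
    by (induction n rule: induct_nat_012)
      (simp_all add: step[OF assms(1)] step[OF assms(2)] numeral_2_eq_2)
  moreover have "u 0 = u' 0" using assms by (simp add: rec_solutions_def)
  ultimately show "u n = u' n" for n by (cases n) auto
qed

text \<open>Two realisable solutions whose initial pairs have non-zero determinant already span all
  solutions, by Cramer's rule.\<close>

lemma dim_realisable_subspace_2:
  assumes e: "e \<in> realisable_solutions B C" and f: "f \<in> realisable_solutions B C"
    and det: "e 1 * f 2 - e 2 * f 1 \<noteq> 0"
  shows "cseq.dim (realisable_subspace B C) = 2"
proof -
  have ef: "e \<in> rec_solutions B C" "f \<in> rec_solutions B C"
    using e f by (auto simp: realisable_solutions_def)
  have f0: "f \<noteq> 0" using det by auto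
  have "e \<notin> cseq.span {f}"
  proof
    assume "e \<in> cseq.span {f}"
    then obtain k where "e = seq_scale k f" by (auto simp: cseq.span_singleton)
    with det show False by (simp add: seq_scale_def)
  qed
  then have ind: "cseq.independent {e, f}" "e \<noteq> f"
    using f0 cseq.span_base[of f "{f}"] by (auto simp: cseq.independent_insert)
  have "u \<in> cseq.span {e, f}" if u: "u \<in> rec_solutions B C" for u
  proof -
    define d where "d = e 1 * f 2 - e 2 * f 1"
    define x where "x = (u 1 * f 2 - u 2 * f 1) / d"
    define y where "y = (e 1 * u 2 - e 2 * u 1) / d"
    have "d \<noteq> 0" using det by (simp add: d_def)
    have "u = seq_scale x e + seq_scale y f"
    proof (rule rec_solutions_eqI[OF u])
      show "seq_scale x e + seq_scale y f \<in> rec_solutions B C"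
        using subspace_rec_solutions ef by (intro cseq.subspace_add cseq.subspace_scale) auto
      have "d * u 1 = d * (x * e 1 + y * f 1)" "d * u 2 = d * (x * e 2 + y * f 2)"
        using \<open>d \<noteq> 0\<close> by (simp_all add: x_def y_def distrib_left) (simp_all add: d_def algebra_simps)
      then show "u 1 = (seq_scale x e + seq_scale y f) 1" "u 2 = (seq_scale x e + seq_scale y f) 2"
        using \<open>d \<noteq> 0\<close> by (simp_all add: seq_scale_def)
    qed
    also have "\<dots> \<in> cseq.span {e, f}"
      by (intro cseq.span_add cseq.span_scale cseq.span_base) auto
    finally show ?thesis .
  qed
  then have "realisable_subspace B C \<subseteq> cseq.span {e, f}"
    using realisable_subspace_subset by blast
  moreover have "{e, f} \<subseteq> realisable_subspace B C"
    using e f by (auto simp: realisable_subspace_def intro: cseq.span_base)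
  ultimately have "card {e, f} = cseq.dim (realisable_subspace B C)"
    using ind(1) by (intro cseq.basis_card_eq_dim) auto
  then show ?thesis using ind(2) by simp
qed

lemma lucas_V_uminus: "lucas_V (- B) C n = (-1) ^ n * lucas_V B C n"
  by (induction n rule: induct_nat_012) (simp_all add: algebra_simps)

text \<open>Replacing B by -B negates both roots and changes V_n only by a sign, which reduces to B
  \<ge> 0.\<close>

lemma realisable_abs_lucas_V:
  assumes "B\<^sup>2 - 4 * C \<ge> 0"
  shows "realisable (\<lambda>n. nat \<bar>lucas_V B C n\<bar>)"
proof -
  have "\<bar>lucas_V B C n\<bar> = lucas_V (\<bar>B\<bar>) C n" for n
  proof -
    have "\<bar>lucas_V B C n\<bar> = \<bar>lucas_V (\<bar>B\<bar>) C n\<bar>"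
      by (cases "B \<ge> 0") (simp_all add: lucas_V_uminus abs_mult power_abs)
    then show ?thesis using lucas_V_realisable(1)[of "\<bar>B\<bar>" C n] assms by simp
  qed
  then show ?thesis using lucas_V_realisable(2)[of "\<bar>B\<bar>" C] assms by simp
qed

text \<open>For C = 0 the roots are |x| and 0, so V_n = |x|^n from n = 1 on. The values at 0 differ,
  but realisability does not see them.\<close>

lemma realisable_abs_power: "realisable (\<lambda>n. nat (\<bar>x :: int\<bar> ^ n))"
proof -
  have "lucas_V (\<bar>x\<bar>) 0 (Suc n) = \<bar>x\<bar> ^ Suc n" for n
    by (induction n) auto
  then have "lucas_V (\<bar>x\<bar>) 0 n = \<bar>x\<bar> ^ n" if "n \<ge> 1" for n
    using that by (cases n) auto
  then have "realisable (\<lambda>n. nat (\<bar>x\<bar> ^ n)) \<longleftrightarrow> realisable (\<lambda>n. nat (lucas_V \<bar>x\<bar> 0 n))"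
    by (intro realisable_cong) simp
  then show ?thesis using lucas_V_realisable(2)[of "\<bar>x\<bar>" 0] by simp
qed

text \<open>V is realisable and non-zero, as V_1 = B. The proportionality of w to V is stated over
  the integers, with the ratio w_1 / B cleared.\<close>

lemma dim_realisable_subspace_1:
  assumes B: "B \<noteq> 0" and D: "B\<^sup>2 - 4 * C \<ge> 0"
    and proportional: "\<And>w n. \<lbrakk>recurrent B C w; realisable (\<lambda>n. nat \<bar>w n\<bar>); n \<ge> 1\<rbrakk> \<Longrightarrow> B * w n = w 1 * lucas_V B C n"
  shows "cseq.dim (realisable_subspace B C) = 1"
proof -
  define e where "e = (\<lambda>n. if n = 0 then 0 else complex_of_int (lucas_V B C n))"
  have e: "e \<in> realisable_solutions B C"
    unfolding e_def by (intro realisable_solutionsI recurrent_lucas realisable_abs_lucas_V D)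
  have "e 1 \<noteq> 0" using B by (simp add: e_def)
  then have "e \<noteq> 0" by auto
  have "realisable_solutions B C \<subseteq> cseq.span {e}"
  proof
    fix u assume "u \<in> realisable_solutions B C"
    then obtain w where w: "u = (\<lambda>n. of_int (w n))" "w 0 = 0" "recurrent B C w" "realisable (\<lambda>n. nat \<bar>w n\<bar>)"
      by (rule realisable_solutionsE)
    have "u n = of_int (w 1) / of_int B * e n" for n
    proof (cases "n = 0")
      case False
      then have "B * w n = w 1 * lucas_V B C n" by (intro proportional w) simp
      then have "of_int B * of_int (w n) = (of_int (w 1) * of_int (lucas_V B C n) :: complex)"
        by (simp only: of_int_mult[symmetric])
      then show ?thesis using B False by (simp add: w(1) e_def field_simps)
    qed (simp add: w e_def)
    then have "u = seq_scale (of_int (w 1) / of_int B) e" by (auto simp: seq_scale_def)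
    then show "u \<in> cseq.span {e}" by (simp only:) (intro cseq.span_scale cseq.span_base singletonI)
  qed
  then have "realisable_subspace B C \<subseteq> cseq.span {e}"
    unfolding realisable_subspace_def by (simp add: cseq.span_minimal)
  moreover have "{e} \<subseteq> realisable_subspace B C"
    using e by (auto simp: realisable_subspace_def intro: cseq.span_base)
  ultimately have "card {e} = cseq.dim (realisable_subspace B C)"
    using \<open>e \<noteq> 0\<close> by (intro cseq.basis_card_eq_dim) auto
  then show ?thesis by simp
qed

text \<open>For non-zero integer roots the two sequences of powers are realisable in absolute value
  and independent. A zero root contributes only the zero sequence of powers, so that case needs
  another second solution.\<close>

lemma dim_realisable_subspace_split:
  fixes x y :: int
  assumes "x \<noteq> y"
  shows "cseq.dim (realisable_subspace (x + y) (x * y)) = 2"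
proof -
  have geom: "recurrent (x + y) (x * y) (\<lambda>n. x ^ n)" for x y :: int
    by (simp add: recurrent_def algebra_simps)
  have sol: "(\<lambda>n. if n = 0 then 0 else complex_of_int (x ^ n)) \<in> realisable_solutions (x + y) (x * y)" for x y
    using realisable_abs_power[of x] by (intro realisable_solutionsI geom) (simp add: power_abs)
  show ?thesis
  proof (cases "x * y = 0")
    case False
    show ?thesis
    proof (rule dim_realisable_subspace_2[OF sol])
      show "(\<lambda>n. if n = 0 then 0 else complex_of_int (y ^ n)) \<in> realisable_solutions (x + y) (x * y)"
        using sol[of y x] by (simp add: add.commute mult.commute)
      have "x * y\<^sup>2 - x\<^sup>2 * y = x * y * (y - x)" by (simp add: power2_eq_square algebra_simps)
      then have "x * y\<^sup>2 - x\<^sup>2 * y \<noteq> 0" using assms False by simp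
      then have "complex_of_int (x * y\<^sup>2 - x\<^sup>2 * y) \<noteq> 0" by (simp only: of_int_eq_0_iff not_False_eq_True)
      then show "(if (1::nat) = 0 then 0 else complex_of_int (x ^ 1)) * (if (2::nat) = 0 then 0 else complex_of_int (y ^ 2)) -
        (if (2::nat) = 0 then 0 else complex_of_int (x ^ 2)) * (if (1::nat) = 0 then 0 else complex_of_int (y ^ 1)) \<noteq> 0"
        by simp
    qed
  next
    case True
    define z where "z = x + y"
    have "z \<noteq> 0" using True assms by (auto simp: z_def)
    \<comment> \<open>With a zero root the first term is free, and changing its sign does not change \<open>\<bar>w\<bar>\<close>.\<close>
    define w where "w = (\<lambda>n::nat. if n = 1 then - z else z ^ n)"
    have "recurrent z 0 w" by (auto simp: recurrent_def w_def)
    moreover have "realisable (\<lambda>n. nat \<bar>w n\<bar>)"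
      using realisable_abs_power[of z] realisable_cong[of "\<lambda>n. nat (\<bar>z\<bar> ^ n)" "\<lambda>n. nat \<bar>w n\<bar>"]
      by (simp add: w_def power_abs)
    ultimately have "(\<lambda>n. if n = 0 then 0 else complex_of_int (w n)) \<in> realisable_solutions z 0"
      by (rule realisable_solutionsI)
    then have "cseq.dim (realisable_subspace z 0) = 2"
    proof (rule dim_realisable_subspace_2)
      show "(\<lambda>n. if n = 0 then 0 else complex_of_int (z ^ n)) \<in> realisable_solutions z 0"
        using sol[of z 0] by simp
    qed (use \<open>z \<noteq> 0\<close> in \<open>simp add: w_def power2_eq_square\<close>)
    then show ?thesis by (simp only: True z_def)
  qed
qed

lemma dim_realisable_subspace_double_root:
  fixes B C :: int
  assumes "B \<noteq> 0" "B\<^sup>2 - 4 * C = 0"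
  shows "cseq.dim (realisable_subspace B C) = 1"
proof (rule dim_realisable_subspace_1)
  have "B\<^sup>2 = 2 * (2 * C)" using assms(2) by simp
  then have "even (B\<^sup>2)" by (simp only: dvd_triv_left)
  then obtain b where b: "B = 2 * b" by auto
  then have C: "C = b\<^sup>2" using assms(2) by (simp add: power2_eq_square)
  fix w :: "nat \<Rightarrow> int" and n :: nat
  assume w: "recurrent B C w" "realisable (\<lambda>n. nat \<bar>w n\<bar>)" and "n \<ge> 1"
  have w2: "w 2 = b * w 1"
    using double_root_realisable_geometric[of b w] w assms(1) by (simp add: b C)
  \<comment> \<open>The zero summands bring both sides into the shape of
    \<open>recurrent_linear\<close>.\<close>
  have rec: "recurrent B C (\<lambda>n. B * w n + 0 * w n)" "recurrent B C (\<lambda>n. w 1 * lucas_V B C n + 0 * w n)"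
    by (intro recurrent_linear w recurrent_lucas)+
  have V: "lucas_V B C 2 = 2 * b\<^sup>2"
    by (simp_all add: numeral_2_eq_2 b C)
  have "B * w n + 0 * w n = w 1 * lucas_V B C n + 0 * w n"
  proof (rule recurrent_eqI[OF rec _ _ \<open>n \<ge> 1\<close>])
    show "B * w 1 + 0 * w 1 = w 1 * lucas_V B C 1 + 0 * w 1" by simp
    show "B * w 2 + 0 * w 2 = w 1 * lucas_V B C 2 + 0 * w 2"
      unfolding V w2 by (simp add: b power2_eq_square)
  qed
  then show "B * w n = w 1 * lucas_V B C n" by simp
qed (use assms in auto)

lemma dim_realisable_subspace_nonsquare:
  fixes B C :: int
  assumes "B \<noteq> 0" "B\<^sup>2 - 4 * C > 0" "\<not> is_square (B\<^sup>2 - 4 * C)"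
  shows "cseq.dim (realisable_subspace B C) = 1"
proof (rule dim_realisable_subspace_1)
  have "C \<noteq> 0" using assms(3) by auto
  fix w :: "nat \<Rightarrow> int" and n :: nat
  assume w: "recurrent B C w" "realisable (\<lambda>n. nat \<bar>w n\<bar>)" and n: "n \<ge> 1"
  define g where "g = B * w 1 - w 2"
  have "2 * C * w m = g * lucas_V B C m" if "m \<ge> 1" for m
    unfolding g_def by (rule nonsquare_realisable_proportional[OF w assms that])
  \<comment> \<open>The instance at index 1, where V_1 = B, serves to eliminate g.\<close>
  from this[OF n] this[of 1] have "2 * C * w n = g * lucas_V B C n" "2 * C * w 1 = g * B" by simp_all
  then have "2 * C * (B * w n) = 2 * C * (w 1 * lucas_V B C n)"
    by (metis mult.assoc mult.commute)
  then show "B * w n = w 1 * lucas_V B C n" using \<open>C \<noteq> 0\<close> by simp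
qed (use assms in auto)

lemma dim_realisable_subspace_negative:
  fixes \<alpha> :: complex
  assumes "B\<^sup>2 - 4 * C < 0" "of_int B = \<alpha> + cnj \<alpha>" "of_int C = \<alpha> * cnj \<alpha>"
    and "\<And>k. k \<ge> 1 \<Longrightarrow> (\<alpha> / cnj \<alpha>) ^ k \<noteq> 1"
  shows "cseq.dim (realisable_subspace B C) = 0"
proof -
  have "realisable_solutions B C \<subseteq> {0}"
  proof
    fix u assume "u \<in> realisable_solutions B C"
    then obtain w where w: "u = (\<lambda>n. of_int (w n))" "w 0 = 0" "recurrent B C w" "realisable (\<lambda>n. nat \<bar>w n\<bar>)"
      by (rule realisable_solutionsE)
    have "w n = 0" for n
      using negative_discriminant_realisable_zero[OF w(3,4) assms, of n] w(2) by (cases n) auto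
    then show "u \<in> {0}" by (auto simp: w(1))
  qed
  then have "realisable_subspace B C \<subseteq> cseq.span {}"
    unfolding realisable_subspace_def
    by (intro cseq.span_minimal cseq.subspace_span) (auto simp: cseq.span_zero)
  then have "card ({} :: (nat \<Rightarrow> complex) set) = cseq.dim (realisable_subspace B C)"
    by (intro cseq.basis_card_eq_dim) (auto simp: cseq.independent_empty)
  then show ?thesis by simp
qed

theorem theorem1p1:
  fixes B C \<Delta> :: int and \<alpha>1 \<alpha>2 :: complex
  assumes roots: "[:of_int C, - of_int B, 1:] = [:- \<alpha>1, 1:] * [:- \<alpha>2, 1:]"
    and nondeg: "nondegenerate \<alpha>1 \<alpha>2"
    and disc: "\<Delta> = B\<^sup>2 - 4 * C"
  shows "(\<Delta> < 0 \<longrightarrow> cseq.dim (realisable_subspace B C) = 0) \<and>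
         (\<Delta> = 0 \<or> (\<Delta> > 0 \<and> \<not> is_square \<Delta>) \<longrightarrow> cseq.dim (realisable_subspace B C) = 1) \<and>
         (\<Delta> > 0 \<and> is_square \<Delta> \<longrightarrow> cseq.dim (realisable_subspace B C) = 2)"
proof -
  have B: "of_int B = \<alpha>1 + \<alpha>2" and C: "of_int C = \<alpha>1 * \<alpha>2"
    using roots by (auto simp: algebra_simps minus_equation_iff[of "of_int B"])
  have "cseq.dim (realisable_subspace B C) = 0" if neg: "\<Delta> < 0"
  proof -
    \<comment> \<open>The conjugate of a root is a root of the same real polynomial, hence one of
      the two. It is not \<alpha>1 itself, since a real root would make the discriminant a real
      square.\<close>
    have "(cnj \<alpha>1 - \<alpha>1) * (cnj \<alpha>1 - \<alpha>2) = (cnj \<alpha>1)\<^sup>2 - of_int B * cnj \<alpha>1 + of_int C"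
      unfolding B C by (simp add: power2_eq_square algebra_simps)
    also have "\<dots> = cnj (\<alpha>1\<^sup>2 - of_int B * \<alpha>1 + of_int C)" by simp
    also have "\<dots> = 0" unfolding B C by (simp add: power2_eq_square algebra_simps)
    finally have "cnj \<alpha>1 = \<alpha>1 \<or> \<alpha>2 = cnj \<alpha>1" by auto
    moreover have "cnj \<alpha>1 \<noteq> \<alpha>1"
    proof
      assume "cnj \<alpha>1 = \<alpha>1"
      then have "\<alpha>1 = complex_of_real (Re \<alpha>1)" by (simp add: complex_eq_iff)
      then obtain r where r: "\<alpha>1 = complex_of_real r" by blast
      have "complex_of_int \<Delta> = (2 * \<alpha>1 - of_int B)\<^sup>2"
        unfolding disc of_int_diff of_int_mult of_int_power of_int_numeral B C
        by (simp add: power2_eq_square algebra_simps)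
      also have "\<dots> = complex_of_real ((2 * r - of_int B)\<^sup>2)" by (simp add: r)
      finally have "complex_of_real (of_int \<Delta>) = complex_of_real ((2 * r - of_int B)\<^sup>2)" by simp
      then have "real_of_int \<Delta> = (2 * r - of_int B)\<^sup>2" by (simp only: of_real_eq_iff)
      then have "real_of_int \<Delta> \<ge> 0" by simp
      with neg show False by simp
    qed
    ultimately have cnj: "\<alpha>2 = cnj \<alpha>1" "\<alpha>1 \<noteq> \<alpha>2" by auto
    then have "(\<alpha>1 / cnj \<alpha>1) ^ k \<noteq> 1" if "k \<ge> 1" for k
      using nondeg that by (auto simp: nondegenerate_def root_of_unity_def)
    then show ?thesis
      using dim_realisable_subspace_negative[of B C \<alpha>1] neg B C by (simp add: disc cnj(1))
  qed
  moreover have "cseq.dim (realisable_subspace B C) = 1" if "\<Delta> = 0 \<or> (\<Delta> > 0 \<and> \<not> is_square \<Delta>)"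
  proof -
    \<comment> \<open>B = 0 would give either the excluded double root 0 or the ratio -1, a root of
      unity.\<close>
    have "B \<noteq> 0"
    proof
      assume "B = 0"
      then have \<alpha>2: "\<alpha>2 = - \<alpha>1" using B by (simp add: eq_neg_iff_add_eq_0 add.commute)
      have "\<alpha>1 \<noteq> 0" using nondeg \<alpha>2 by (auto simp: nondegenerate_def)
      then have "\<alpha>1 \<noteq> \<alpha>2" "(\<alpha>1 / \<alpha>2)\<^sup>2 = 1" unfolding \<alpha>2 by auto
      then show False using nondeg
        unfolding nondegenerate_def root_of_unity_def by (metis one_le_numeral)
    qed
    then show ?thesis
      using that dim_realisable_subspace_double_root dim_realisable_subspace_nonsquare
      unfolding disc by blast
  qed
  moreover have "cseq.dim (realisable_subspace B C) = 2" if pos: "\<Delta> > 0" and square: "is_square \<Delta>"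
  proof -
    \<comment> \<open>B and r have the same parity, so the roots (B + r) / 2 and (B - r) / 2 are
      integers, distinct as r is non-zero.\<close>
    obtain r where r: "B\<^sup>2 - 4 * C = r\<^sup>2" using square disc by (auto elim: is_nth_powerE)
    then have "r \<noteq> 0" using pos disc by auto
    have "B\<^sup>2 - r\<^sup>2 = 2 * (2 * C)" using r by simp
    then have "even (B\<^sup>2 - r\<^sup>2)" by (simp only: dvd_triv_left)
    then have "even (B + r)" by simp
    then obtain x where x: "B + r = 2 * x" by blast
    define y where "y = B - x"
    have "r = x - y" "B = x + y" using x by (simp_all add: y_def)
    then have "4 * C = (x + y)\<^sup>2 - (x - y)\<^sup>2" using r by simp
    then have "C = x * y" by (simp add: power2_eq_square algebra_simps)
    then show ?thesis
      using dim_realisable_subspace_split[of x y] \<open>r \<noteq> 0\<close> \<open>r = x - y\<close> \<open>B = x + y\<close> by simp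
  qed
  ultimately show ?thesis by blast
qed

end
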